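(* Let $\begin{bmatrix} V & E\\ 0 & S\end{bmatrix}\in\mathscr S_{\mathcal H_1,\mathcal H_2}$ and let $N\in B(\mathcal K_2)$ be a minimal normal extension of $S$. Then there exist a Hilbert space $\mathcal K_1$ and operators $\tilde V\in B(\mathcal K_1)$ and $\tilde E\in B(\mathcal K_2,\mathcal K_1)$ such that $\begin{bmatrix}\tilde V&\tilde E\\0&N\end{bmatrix}\in\mathscr N_{\mathcal K_1,\mathcal K_2}$, $\begin{bmatrix} V & E\\ 0 & S\end{bmatrix}\preceq\begin{bmatrix}\tilde V&\tilde E\\0&N\end{bmatrix}$, $|E|\subseteq|\tilde E|$, $\dim\mathcal K_j=\dim\mathcal H_j$ for $j=1,2$, and $\mathcal K_1=\operatorname{ran}\tilde V\oplus\overline{\operatorname{ran}\tilde E}$.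
   Context: All Hilbert spaces are complex; $\dim$ is Hilbert-space dimension (a cardinal); $B(\mathcal H,\mathcal K)$ is the space of bounded linear operators and $B(\mathcal H)=B(\mathcal H,\mathcal H)$; $|E|=(E^*E)^{1/2}$. $A\subseteq B$ means that $B$ extends $A$: the space of $A$ is (isometrically) a subspace of that of $B$, and $Ah=Bh$ for all $h$ in the space of $A$. For nonzero Hilbert spaces $\mathcal H_1,\mathcal H_2$, the operator $\begin{bmatrix}V&E\\0&X\end{bmatrix}\in B(\mathcal H_1\oplus\mathcal H_2)$ is a Brownian-type operator if $V^*V=I$, $V^*E=0$ and $XE^*E=E^*EX$. It belongs to $\mathscr S_{\mathcal H_1,\mathcal H_2}$ (resp. $\mathscr N_{\mathcal H_1,\mathcal H_2}$) if in addition $X$ is subnormal (resp. normal). $S\in B(\mathcal H)$ is subnormal if $S\subseteq N$ for some normal $N\in B(\mathcal K)$, $\mathcal K\supseteq\mathcal H$ (a normal extension of $S$). The normal extension $N$ is minimal if $\mathcal K$ is the only closed subspace of $\mathcal K$ that contains $\mathcal H$ and reduces $N$. Entrywise extension: $\begin{bmatrix}A_{11}&A_{12}\\ A_{21}&A_{22}\end{bmatrix}\preceq\begin{bmatrix}\tilde A_{11}&\tilde A_{12}\\ \tilde A_{21}&\tilde A_{22}\end{bmatrix}$, for operators on $\mathcal H_1\oplus\mathcal H_2$ and $\mathcal K_1\oplus\mathcal K_2$ respectively, means $\mathcal H_j\subseteq\mathcal K_j$ and $A_{ij}h_j=\tilde A_{ij}h_j$ for all $h_j\in\mathcal H_j$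 and $i,j\in\{1,2\}$. *)

theory Defs
  imports "HOL-Analysis.Analysis"
begin

unbundle cardinal_syntax

section \<open>Complex Hilbert spaces\<close>

text \<open>
  A complex inner product space is a real inner product space with a compatible complex
  structure; \<open>cinner\<close> is linear in the first argument, and the norm is the one of
  \<^class>\<open>real_inner\<close>, so that \<open>(norm x)\<^sup>2 = cinner x x\<close>.
\<close>

class complex_inner = real_inner +
  fixes scaleC :: "complex \<Rightarrow> 'a \<Rightarrow> 'a" (infixr "*\<^sub>C" 75)
    and cinner :: "'a \<Rightarrow> 'a \<Rightarrow> complex"
  assumes scaleC_add_right: "c *\<^sub>C (x + y) = c *\<^sub>C x + c *\<^sub>C y"
    and scaleC_add_left: "(c + d) *\<^sub>C x = c *\<^sub>C x + d *\<^sub>C x"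
    and scaleC_scaleC: "c *\<^sub>C d *\<^sub>C x = (c * d) *\<^sub>C x"
    and scaleR_scaleC: "r *\<^sub>R x = complex_of_real r *\<^sub>C x"
    and cinner_add_left: "cinner (x + y) z = cinner x z + cinner y z"
    and cinner_scaleC_left: "cinner (c *\<^sub>C x) y = c * cinner x y"
    and cinner_commute: "cinner x y = cnj (cinner y x)"
    and inner_cinner: "inner x y = Re (cinner x y)"

class chilbert_space = complex_inner + complete_space

instantiation complex :: chilbert_space
begin

definition scaleC_complex :: "complex \<Rightarrow> complex \<Rightarrow> complex"
  where "scaleC_complex c x = c * x"

definition cinner_complex :: "complex \<Rightarrow> complex \<Rightarrow> complex"
  where "cinner_complex x y = x * cnj y"

instance
  by standard
    (auto simp: scaleC_complex_def cinner_complex_def algebra_simps inner_complex_def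
      scaleR_conv_of_real)

end

text \<open>
  Closed subspaces serve as carriers, so that a Hilbert space can be quantified over
  existentially. All notions below are relative to carriers: an operator is a function on
  the ambient type of which only the values on the carrier matter, and equality of
  operators always means equality on the carrier.
\<close>

definition hilbert :: "'a::chilbert_space set \<Rightarrow> bool" where
  "hilbert H \<longleftrightarrow> 0 \<in> H \<and> (\<forall>x\<in>H. \<forall>y\<in>H. x + y \<in> H) \<and> (\<forall>c. \<forall>x\<in>H. c *\<^sub>C x \<in> H) \<and> closed H"

definition orthonormal_basis :: "'a::chilbert_space set \<Rightarrow> 'a set \<Rightarrow> bool" where
  "orthonormal_basis H B \<longleftrightarrow> B \<subseteq> H \<and> (\<forall>b\<in>B. \<forall>b'\<in>B. cinner b b' = (if b = b' then 1 else 0)) \<and>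
     (\<forall>x\<in>H. (\<forall>b\<in>B. cinner x b = 0) \<longrightarrow> x = 0)"

text \<open>Dimensions are cardinals, to be compared with \<open>=o\<close>.\<close>

definition hdim :: "'a::chilbert_space set \<Rightarrow> 'a rel" where
  "hdim H = |SOME B. orthonormal_basis H B|"

definition orthogonal_sum :: "'a::chilbert_space set \<Rightarrow> 'a set \<Rightarrow> 'a set \<Rightarrow> bool" where
  "orthogonal_sum K L M \<longleftrightarrow> (\<forall>x\<in>L. \<forall>y\<in>M. cinner x y = 0) \<and> K = {x + y |x y. x \<in> L \<and> y \<in> M}"


section \<open>Bounded operators\<close>

definition bounded_ops ::
  "'a::chilbert_space set \<Rightarrow> 'b::chilbert_space set \<Rightarrow> ('a \<Rightarrow> 'b) set" where
  "bounded_ops H K = {A. (\<forall>x\<in>H. A x \<in> K) \<and>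
     (\<forall>x\<in>H. \<forall>y\<in>H. A (x + y) = A x + A y) \<and>
     (\<forall>c. \<forall>x\<in>H. A (c *\<^sub>C x) = c *\<^sub>C A x) \<and>
     (\<exists>M. \<forall>x\<in>H. norm (A x) \<le> M * norm x)}"

definition adj ::
  "'a::chilbert_space set \<Rightarrow> 'b::chilbert_space set \<Rightarrow> ('a \<Rightarrow> 'b) \<Rightarrow> 'b \<Rightarrow> 'a" where
  "adj H K A = (SOME B. B \<in> bounded_ops K H \<and>
     (\<forall>x\<in>H. \<forall>y\<in>K. cinner (A x) y = cinner x (B y)))"

definition positive_op :: "'a::chilbert_space set \<Rightarrow> ('a \<Rightarrow> 'a) \<Rightarrow> bool" where
  "positive_op H A \<longleftrightarrow> A \<in> bounded_ops H H \<and>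
     (\<forall>x\<in>H. cinner (A x) x \<in> \<real> \<and> 0 \<le> Re (cinner (A x) x))"

text \<open>The positive square root of \<open>A\<^sup>*A\<close>; its values on \<open>H\<close> are uniquely determined.\<close>

definition abs_op ::
  "'a::chilbert_space set \<Rightarrow> 'b::chilbert_space set \<Rightarrow> ('a \<Rightarrow> 'b) \<Rightarrow> 'a \<Rightarrow> 'a" where
  "abs_op H K A = (SOME B. positive_op H B \<and> (\<forall>x\<in>H. B (B x) = adj H K A (A x)))"

definition normal_op :: "'a::chilbert_space set \<Rightarrow> ('a \<Rightarrow> 'a) \<Rightarrow> bool" where
  "normal_op H N \<longleftrightarrow> N \<in> bounded_ops H H \<and> (\<forall>x\<in>H. adj H H N (N x) = N (adj H H N x))"

definition isometric_embedding ::
  "'a::chilbert_space set \<Rightarrow> 'b::chilbert_space set \<Rightarrow> ('a \<Rightarrow> 'b) \<Rightarrow> bool" where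
  "isometric_embedding H K J \<longleftrightarrow> J \<in> bounded_ops H K \<and> (\<forall>x\<in>H. norm (J x) = norm x)"

text \<open>
  \<open>A \<subseteq> B\<close>, where the inclusion of the space \<open>H\<close> of \<open>A\<close> into the space \<open>K\<close> of \<open>B\<close> is
  the isometric embedding \<open>J\<close>.
\<close>

definition op_extension ::
  "'a::chilbert_space set \<Rightarrow> ('a \<Rightarrow> 'a) \<Rightarrow> 'b::chilbert_space set \<Rightarrow> ('b \<Rightarrow> 'b) \<Rightarrow> ('a \<Rightarrow> 'b) \<Rightarrow> bool"
  where
  "op_extension H A K B J \<longleftrightarrow> isometric_embedding H K J \<and> (\<forall>x\<in>H. J (A x) = B (J x))"

definition normal_extension ::
  "'a::chilbert_space set \<Rightarrow> ('a \<Rightarrow> 'a) \<Rightarrow> 'b::chilbert_space set \<Rightarrow> ('b \<Rightarrow> 'b) \<Rightarrow> ('a \<Rightarrow> 'b) \<Rightarrow> bool"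
  where
  "normal_extension H S K N J \<longleftrightarrow> hilbert K \<and> normal_op K N \<and> op_extension H S K N J"

definition reduces :: "'a::chilbert_space set \<Rightarrow> 'a set \<Rightarrow> ('a \<Rightarrow> 'a) \<Rightarrow> bool" where
  "reduces L K A \<longleftrightarrow> hilbert L \<and> L \<subseteq> K \<and> (\<forall>x\<in>L. A x \<in> L) \<and>
     (let L' = {y\<in>K. \<forall>x\<in>L. cinner y x = 0} in \<forall>y\<in>L'. A y \<in> L')"

definition minimal_normal_extension ::
  "'a::chilbert_space set \<Rightarrow> ('a \<Rightarrow> 'a) \<Rightarrow> 'b::chilbert_space set \<Rightarrow> ('b \<Rightarrow> 'b) \<Rightarrow> ('a \<Rightarrow> 'b) \<Rightarrow> bool"
  where
  "minimal_normal_extension H S K N J \<longleftrightarrow> normal_extension H S K N J \<and>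
     (\<forall>L. reduces L K N \<and> J ` H \<subseteq> L \<longrightarrow> L = K)"

text \<open>
  HOL cannot quantify existentially over the type \<open>'d\<close> in which the normal extension lives,
  so it is a parameter. As a hypothesis with \<open>'d\<close> a free type variable occurring nowhere
  else in a theorem, \<open>subnormal_op TYPE('d) H S\<close> says exactly that \<open>S\<close> has a normal extension
  on some Hilbert space.
\<close>

definition subnormal_op ::
  "'d::chilbert_space itself \<Rightarrow> 'a::chilbert_space set \<Rightarrow> ('a \<Rightarrow> 'a) \<Rightarrow> bool" where
  "subnormal_op (T :: 'd itself) H S \<longleftrightarrow> S \<in> bounded_ops H H \<and>
     (\<exists>(K :: 'd set) N J. normal_extension H S K N J)"


section \<open>Operator matrices\<close>

text \<open>An operator on \<open>H1 \<oplus> H2\<close> is identified with its matrix of entries.\<close>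

datatype ('a, 'b) opmat =
  OpMat (ent11: "'a \<Rightarrow> 'a") (ent12: "'b \<Rightarrow> 'a") (ent21: "'a \<Rightarrow> 'b") (ent22: "'b \<Rightarrow> 'b")

definition bounded_opmats ::
  "'a::chilbert_space set \<Rightarrow> 'b::chilbert_space set \<Rightarrow> ('a, 'b) opmat set" where
  "bounded_opmats H1 H2 = {A. ent11 A \<in> bounded_ops H1 H1 \<and> ent12 A \<in> bounded_ops H2 H1 \<and>
     ent21 A \<in> bounded_ops H1 H2 \<and> ent22 A \<in> bounded_ops H2 H2}"

definition brownian_type ::
  "'a::chilbert_space set \<Rightarrow> 'b::chilbert_space set \<Rightarrow> ('a, 'b) opmat \<Rightarrow> bool" where
  "brownian_type H1 H2 A \<longleftrightarrow> hilbert H1 \<and> H1 \<noteq> {0} \<and> hilbert H2 \<and> H2 \<noteq> {0} \<and>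
     A \<in> bounded_opmats H1 H2 \<and> (\<forall>x\<in>H1. ent21 A x = 0) \<and>
     (let V = ent11 A; E = ent12 A; X = ent22 A; Va = adj H1 H1 V; Ea = adj H2 H1 E in
       (\<forall>x\<in>H1. Va (V x) = x) \<and> (\<forall>y\<in>H2. Va (E y) = 0) \<and>
       (\<forall>y\<in>H2. X (Ea (E y)) = Ea (E (X y))))"

definition brownian_subnormal ::
  "'d::chilbert_space itself \<Rightarrow> 'a::chilbert_space set \<Rightarrow> 'b::chilbert_space set \<Rightarrow>
    ('a, 'b) opmat set" where
  "brownian_subnormal T H1 H2 = {A. brownian_type H1 H2 A \<and> subnormal_op T H2 (ent22 A)}"

definition brownian_normal ::
  "'a::chilbert_space set \<Rightarrow> 'b::chilbert_space set \<Rightarrow> ('a, 'b) opmat set" where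
  "brownian_normal H1 H2 = {A. brownian_type H1 H2 A \<and> normal_op H2 (ent22 A)}"

definition opmat_extension ::
  "'a::chilbert_space set \<Rightarrow> 'b::chilbert_space set \<Rightarrow> ('a, 'b) opmat \<Rightarrow>
    'c::chilbert_space set \<Rightarrow> 'd::chilbert_space set \<Rightarrow> ('c, 'd) opmat \<Rightarrow>
    ('a \<Rightarrow> 'c) \<Rightarrow> ('b \<Rightarrow> 'd) \<Rightarrow> bool" where
  "opmat_extension H1 H2 A K1 K2 B J1 J2 \<longleftrightarrow>
     isometric_embedding H1 K1 J1 \<and> isometric_embedding H2 K2 J2 \<and>
     (\<forall>x\<in>H1. J1 (ent11 A x) = ent11 B (J1 x)) \<and> (\<forall>y\<in>H2. J1 (ent12 A y) = ent12 B (J2 y)) \<and>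
     (\<forall>x\<in>H1. J2 (ent21 A x) = ent21 B (J1 x)) \<and> (\<forall>y\<in>H2. J2 (ent22 A y) = ent22 B (J2 y))"

end

theory Submission
  imports Defs
begin

text \<open>
  The modulus of \<open>E\<close> commutes with \<open>S\<close> and lifts to a positive operator \<open>B\<close> commuting with \<open>N\<close>.
  It remains to find an isometry \<open>Vt\<close> extending \<open>V\<close> and an operator \<open>Et\<close> extending \<open>E\<close> with
  \<open>|Et| = B\<close> whose range is dense in \<open>ker Vt\<^sup>*\<close>. By the Wold decomposition \<open>V\<close> is a unitary plus a
  shift generated by \<open>ker V\<^sup>*\<close>, which contains \<open>ran E\<close>. The part of the shift generated by
  \<open>ker V\<^sup>* \<ominus> ran E\<close> is extended to a bilateral shift, and in the remaining part the closure of
  \<open>ran E\<close> is enlarged to that of \<open>ran B\<close>. If \<open>V\<close> is not unitary, its space is infinite-dimensional,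
  and since \<open>N\<close> is minimal, \<open>ran B\<close> is generated by countably many images of \<open>ran E\<close>; hence the
  enlarged space is realised inside the original one by relabelling an orthonormal basis.
\<close>

section \<open>Complex inner products\<close>

text \<open>The last requirement of the theorem forces \<open>ker Vt\<^sup>*\<close> to be the
  closure of \<open>ran Et\<close>. Vectors of \<open>ker V\<^sup>*\<close> orthogonal to
  \<open>ran E\<close> therefore have to enter the range of \<open>Vt\<close>, which is why their
  unilateral shift becomes bilateral, while the vectors \<open>E y\<close> have to stay outside it.
  Prescribing the modulus fixes \<open>Et\<close> up to an isometry on the closure of
  \<open>ran B\<close>, so room must be found for a copy of that space. The obstacle is the
  dimension, which must not grow. Hence \<open>K1\<close> is the old space itself, and the
  nontrivial object is the embedding \<open>J1\<close>: it fixes the unitary part of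
  \<open>V\<close> pointwise and carries the rest to its place in the relabelled basis. If
  \<open>V\<close> is unitary, then \<open>V\<^sup>* E = 0\<close> gives \<open>E = 0\<close>, hence
  \<open>B = 0\<close>, and nothing has to be added; so relabelling happens only where there is
  infinitely much room. An operator commuting with a subnormal operator need not extend to the
  minimal normal extension; for the modulus it is self-adjointness that makes the lift
  possible.\<close>

lemma scaleC_zero_left [simp]: "0 *\<^sub>C (x::'a::complex_inner) = 0"
  using scaleR_scaleC[of 0 x] by simp

lemma scaleC_one [simp]: "1 *\<^sub>C (x::'a::complex_inner) = x"
  using scaleR_scaleC[of 1 x] by simp

lemma scaleC_zero_right [simp]: "c *\<^sub>C (0::'a::complex_inner) = 0"
  using scaleC_add_right[of c "0::'a" 0] by simp

lemma cinner_add_right: "cinner x (y + z) = cinner x y + cinner (x::'a::complex_inner) z"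
  by (metis cinner_add_left cinner_commute complex_cnj_add)

lemma cinner_scaleC_right: "cinner x (c *\<^sub>C y) = cnj c * cinner (x::'a::complex_inner) y"
  by (metis cinner_commute cinner_scaleC_left complex_cnj_mult)

lemma cinner_zero_left [simp]: "cinner 0 (x::'a::complex_inner) = 0"
  using cinner_scaleC_left[of 0 0 x] by simp

lemma cinner_zero_right [simp]: "cinner (x::'a::complex_inner) 0 = 0"
  using cinner_scaleC_right[of x 0 0] by simp

lemma cinner_minus_left: "cinner (- x) y = - cinner (x::'a::complex_inner) y"
  using cinner_add_left[of x "-x" y] by (simp add: eq_neg_iff_add_eq_0 add.commute)

lemma cinner_minus_right: "cinner x (- y) = - cinner (x::'a::complex_inner) y"
  using cinner_add_right[of x y "-y"] by (simp add: eq_neg_iff_add_eq_0 add.commute)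

lemma cinner_diff_left: "cinner (x - y) z = cinner x z - cinner (y::'a::complex_inner) z"
  using cinner_add_left[of x "-y" z] by (simp add: cinner_minus_left)

lemma cinner_diff_right: "cinner x (y - z) = cinner x y - cinner (x::'a::complex_inner) z"
  using cinner_add_right[of x y "-z"] by (simp add: cinner_minus_right)

lemma cinner_sum_left: "cinner (\<Sum>i\<in>I. f i) y = (\<Sum>i\<in>I. cinner (f i) (y::'a::complex_inner))"
  by (induction I rule: infinite_finite_induct) (auto simp: cinner_add_left)

lemma cinner_sum_right: "cinner y (\<Sum>i\<in>I. f i) = (\<Sum>i\<in>I. cinner (y::'a::complex_inner) (f i))"
  by (induction I rule: infinite_finite_induct) (auto simp: cinner_add_right)

lemma Re_cinner: "Re (cinner x y) = inner (x::'a::complex_inner) y"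
  by (simp add: inner_cinner)

lemma cinner_eq_inner: "cinner (x::'a::complex_inner) y = Complex (inner x y) (inner x (\<i> *\<^sub>C y))"
  by (rule complex_eqI) (auto simp: inner_cinner cinner_scaleC_right)

lemma cinner_self: "cinner x x = complex_of_real ((norm (x::'a::complex_inner))\<^sup>2)"
proof (rule complex_eqI)
  show "Im (cinner x x) = Im (complex_of_real ((norm x)\<^sup>2))"
    using arg_cong[OF cinner_commute[of x x], of Im] by simp
qed (simp add: Re_cinner power2_norm_eq_inner)

lemma cinner_eq_zero_iff [simp]: "cinner x x = 0 \<longleftrightarrow> (x::'a::complex_inner) = 0"
  by (simp add: cinner_self)

lemma cnj_cinner: "cnj (cinner x y) = cinner y (x::'a::complex_inner)"
  by (rule cinner_commute[symmetric])

lemma cinner_eq_zero_commute: "cinner x y = 0 \<longleftrightarrow> cinner (y::'a::complex_inner) x = 0"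
  by (subst cinner_commute) simp

lemma cinner_ext: "(\<And>y. cinner x y = cinner z y) \<Longrightarrow> x = (z::'a::complex_inner)"
  using cinner_eq_zero_iff[of "x - z"] by (simp add: cinner_diff_left)

lemma norm_scaleC: "norm (c *\<^sub>C x) = cmod c * norm (x::'a::complex_inner)"
proof -
  have "complex_of_real ((norm (c *\<^sub>C x))\<^sup>2) = c * cnj c * cinner x x"
    by (simp only: cinner_self[symmetric] cinner_scaleC_left cinner_scaleC_right mult_ac)
  also have "\<dots> = complex_of_real ((cmod c * norm x)\<^sup>2)"
    by (simp add: complex_norm_square[symmetric] cinner_self power_mult_distrib)
  finally have "complex_of_real ((norm (c *\<^sub>C x))\<^sup>2) = complex_of_real ((cmod c * norm x)\<^sup>2)" .
  then show ?thesis by (simp only: of_real_eq_iff) (simp add: power2_eq_iff_nonneg)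
qed

lemma norm_cinner_le: "cmod (cinner x y) \<le> norm x * norm (y::'a::complex_inner)"
proof (cases "cinner x y = 0")
  case False
  let ?z = "cinner x y"
  have "(cmod ?z)\<^sup>2 = inner x (?z *\<^sub>C y)"
    by (metis Re_complex_of_real cinner_scaleC_right complex_norm_square inner_cinner mult.commute)
  also have "\<dots> \<le> norm x * norm (?z *\<^sub>C y)" by (rule norm_cauchy_schwarz)
  finally show ?thesis using False by (simp add: norm_scaleC power2_eq_square)
qed simp

lemma bounded_linear_scaleC: "bounded_linear ((*\<^sub>C) c :: 'a::complex_inner \<Rightarrow> 'a)"
proof (rule bounded_linear_intro)
  fix x y :: 'a and r :: real
  show "c *\<^sub>C (x + y) = c *\<^sub>C x + c *\<^sub>C y" by (rule scaleC_add_right)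
  show "c *\<^sub>C (r *\<^sub>R x) = r *\<^sub>R (c *\<^sub>C x)" by (simp add: scaleR_scaleC scaleC_scaleC mult.commute)
  show "norm (c *\<^sub>C x) \<le> norm x * cmod c" by (simp add: norm_scaleC mult.commute)
qed

lemma continuous_on_scaleC [continuous_intros]:
  fixes f :: "'x::topological_space \<Rightarrow> 'a::complex_inner"
  assumes "continuous_on s f" shows "continuous_on s (\<lambda>x. c *\<^sub>C f x)"
  using bounded_linear.continuous_on[OF bounded_linear_scaleC assms] .

lemma continuous_on_cinner [continuous_intros]:
  fixes f :: "'x::topological_space \<Rightarrow> 'a::complex_inner"
  assumes "continuous_on s f" "continuous_on s g"
  shows "continuous_on s (\<lambda>x. cinner (f x) (g x))"
  unfolding cinner_eq_inner Complex_eq using assms by (intro continuous_intros)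

lemma norm_add_orthogonal:
  assumes "cinner x y = 0" shows "(norm (x + y))\<^sup>2 = (norm x)\<^sup>2 + (norm (y::'a::complex_inner))\<^sup>2"
proof -
  have "inner x y = 0" using assms by (simp add: inner_cinner)
  then show ?thesis by (simp add: power2_norm_eq_inner inner_add_left inner_add_right inner_commute)
qed

section \<open>Bounded operators on whole spaces\<close>

text \<open>The given spaces are whole types and \<open>K1\<close> will be one too, so all operators
  can be treated as \<open>bounded_linear\<close> maps that respect complex scalars.\<close>

definition clin :: "('a::chilbert_space \<Rightarrow> 'b::chilbert_space) \<Rightarrow> bool" where
  "clin A \<longleftrightarrow> bounded_linear A \<and> (\<forall>c x. A (c *\<^sub>C x) = c *\<^sub>C A x)"

lemma bounded_ops_UNIV: "A \<in> bounded_ops UNIV UNIV \<longleftrightarrow> clin A"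
proof
  assume A: "A \<in> bounded_ops UNIV UNIV"
  then obtain M where M: "\<And>x. norm (A x) \<le> M * norm x" by (auto simp: bounded_ops_def)
  have "bounded_linear A"
  proof (rule bounded_linear_intro[where K = M])
    fix x y r
    show "A (x + y) = A x + A y" "A (r *\<^sub>R x) = r *\<^sub>R A x"
      using A by (auto simp: bounded_ops_def scaleR_scaleC)
    show "norm (A x) \<le> norm x * M" using M by (simp add: mult.commute)
  qed
  then show "clin A" using A by (auto simp: clin_def bounded_ops_def)
next
  assume A: "clin A"
  then interpret bounded_linear A by (simp add: clin_def)
  show "A \<in> bounded_ops UNIV UNIV"
    using A bounded add by (auto simp: bounded_ops_def clin_def mult.commute)
qed

lemma clin_bounded_linear: "clin A \<Longrightarrow> bounded_linear A"
  by (simp add: clin_def)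

lemma clin_linear: "clin A \<Longrightarrow> linear A"
  by (simp add: clin_def bounded_linear.linear)

lemma clin_scaleC: "clin A \<Longrightarrow> A (c *\<^sub>C x) = c *\<^sub>C A x"
  by (simp add: clin_def)

lemma clin_add: "clin A \<Longrightarrow> A (x + y) = A x + A y"
  by (simp add: clin_linear linear_add)

lemma clin_diff: "clin A \<Longrightarrow> A (x - y) = A x - A y"
  by (simp add: clin_linear linear_diff)

lemma clin_zero: "clin A \<Longrightarrow> A 0 = 0"
  by (simp add: clin_linear linear_0)

lemma clin_compose: "clin A \<Longrightarrow> clin B \<Longrightarrow> clin (\<lambda>x. A (B x))"
  by (simp add: clin_def bounded_linear_compose)

lemma clin_funpow: "clin A \<Longrightarrow> clin ((A :: 'a::chilbert_space \<Rightarrow> 'a) ^^ n)"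
proof (induction n)
  case 0
  have "A ^^ 0 = (\<lambda>x. x)" by auto
  then show ?case by (simp only: clin_def bounded_linear_ident) simp
next
  case (Suc n)
  then show ?case using clin_compose[of A "A ^^ n"] by (simp add: o_def)
qed

lemma clin_continuous_on:
  "clin A \<Longrightarrow> continuous_on s f \<Longrightarrow> continuous_on s (\<lambda>x. A (f x))"
  by (simp add: clin_def bounded_linear.continuous_on)

lemma clin_bound: assumes "clin A" obtains M where "M > 0" "\<And>x. norm (A x) \<le> M * norm x"
  using bounded_linear.pos_bounded[OF clin_bounded_linear[OF assms]] by (metis mult.commute)

text \<open>The parallelogram law makes every minimizing sequence of
  \<open>\<parallel>x\<parallel>\<^sup>2 - 2 g x\<close> a Cauchy sequence; its limit represents \<open>g\<close>.\<close>

lemma riesz_real: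
  fixes g :: "'a::{real_inner,complete_space} \<Rightarrow> real"
  assumes K: "subspace K" "closed K" and g: "bounded_linear g"
  shows "\<exists>z\<in>K. \<forall>x\<in>K. g x = inner x z"
proof -
  interpret g: bounded_linear g by (rule g)
  define \<phi> where "\<phi> x = (norm x)\<^sup>2 - 2 * g x" for x
  obtain C where C: "\<And>x. norm (g x) \<le> norm x * C" using g.bounded by blast
  have lb: "\<phi> x \<ge> - C\<^sup>2" for x
  proof -
    have "g x \<le> norm x * C" using C[of x] by simp
    moreover have "0 \<le> (norm x - C)\<^sup>2" by simp
    ultimately show ?thesis by (simp add: \<phi>_def power2_diff)
  qed
  define m where "m = Inf (\<phi> ` K)"
  have bdd: "bdd_below (\<phi> ` K)" using lb by (auto intro!: bdd_belowI)
  have m: "m \<le> \<phi> x" if "x \<in> K" for x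
    unfolding m_def using that bdd by (intro cInf_lower) auto
  have ne: "K \<noteq> {}" using subspace_0[OF K(1)] by blast
  have "\<exists>x\<in>K. \<phi> x < m + 1 / Suc n" for n
  proof -
    have "Inf (\<phi> ` K) < m + 1 / Suc n" by (simp add: m_def)
    then show ?thesis using bdd ne by (subst (asm) cInf_less_iff) auto
  qed
  then obtain X where X: "\<And>n. X n \<in> K" "\<And>n. \<phi> (X n) < m + 1 / Suc n" by metis
  have mid: "(norm (x - y))\<^sup>2 \<le> 2 * (\<phi> x + \<phi> y - 2 * m)" if "x \<in> K" "y \<in> K" for x y
  proof -
    have "(1/2) *\<^sub>R (x + y) \<in> K" using that K by (intro subspace_scale subspace_add)
    from m[OF this] have "m \<le> (norm ((1/2) *\<^sub>R (x + y)))\<^sup>2 - (g x + g y)"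
      by (simp add: \<phi>_def g.scaleR g.add add_divide_distrib)
    moreover have "(norm ((1/2) *\<^sub>R (x + y)))\<^sup>2 = (norm (x + y))\<^sup>2 / 4"
      by (simp add: power_divide)
    moreover have "(norm (x - y))\<^sup>2 + (norm (x + y))\<^sup>2 = 2 * (norm x)\<^sup>2 + 2 * (norm y)\<^sup>2"
      by (simp add: power2_norm_eq_inner inner_diff inner_add inner_commute)
    ultimately show ?thesis by (simp add: \<phi>_def)
  qed
  have "Cauchy X"
  proof (rule metric_CauchyI)
    fix e :: real assume e: "0 < e"
    obtain M where M: "4 / e\<^sup>2 < real M" using reals_Archimedean2 by blast
    show "\<exists>M. \<forall>m\<ge>M. \<forall>n\<ge>M. dist (X m) (X n) < e"
    proof (intro exI allI impI)
      fix i j assume ij: "i \<ge> M" "j \<ge> M"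
      have M0: "real M > 0" using M e by (smt (verit) divide_nonneg_nonneg zero_le_power2)
      have le: "1 / real (Suc k) \<le> 1 / real M" if "k \<ge> M" for k
        using that M0 by (intro divide_left_mono) auto
      have "(norm (X i - X j))\<^sup>2 \<le> 2 * (\<phi> (X i) + \<phi> (X j) - 2 * m)" using mid X(1) by blast
      also have "\<dots> < 4 / real M" using X(2)[of i] X(2)[of j] le[OF ij(1)] le[OF ij(2)] by simp
      also have "\<dots> < e\<^sup>2" using M M0 e by (simp add: field_simps)
      finally show "dist (X i) (X j) < e" using e by (simp add: dist_norm power2_less_imp_less)
    qed
  qed
  then obtain z where z: "X \<longlonglongrightarrow> z" using Cauchy_convergent convergent_def by blast
  have zK: "z \<in> K" using z X(1) K(2) by (simp add: closed_sequential_limits) blast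
  have "(\<lambda>n. \<phi> (X n)) \<longlonglongrightarrow> \<phi> z" unfolding \<phi>_def by (intro tendsto_intros z g.tendsto)
  moreover have "(\<lambda>n. m + 1 / Suc n) \<longlonglongrightarrow> m + 0"
    using LIMSEQ_inverse_real_of_nat by (intro tendsto_intros) (simp add: inverse_eq_divide)
  ultimately have "\<phi> z \<le> m + 0"
    by (rule LIMSEQ_le) (use X(2) in \<open>auto intro: less_imp_le\<close>)
  then have zm: "\<phi> z \<le> \<phi> y" if "y \<in> K" for y using m[OF that] by simp
  have "g x = inner x z" if x: "x \<in> K" for x
  proof -
    \<comment> \<open>First variation: \<open>z + t *\<^sub>R x\<close> stays in \<open>K\<close>,
      so minimality of \<open>z\<close> makes this quadratic in \<open>t\<close>
      nonnegative.\<close>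
    have "0 \<le> t * (2 * (inner x z - g x)) + t\<^sup>2 * (norm x)\<^sup>2" for t
    proof -
      have "z + t *\<^sub>R x \<in> K" using x zK K by (intro subspace_scale subspace_add)
      from zm[OF this] have "(norm z)\<^sup>2 \<le> (norm (z + t *\<^sub>R x))\<^sup>2 - 2 * t * g x"
        by (simp add: \<phi>_def g.add g.scaleR algebra_simps)
      also have "(norm (z + t *\<^sub>R x))\<^sup>2 = (norm z)\<^sup>2 + 2 * t * inner x z + t\<^sup>2 * (norm x)\<^sup>2"
        unfolding power2_norm_eq_inner
        by (simp add: inner_add algebra_simps inner_commute power2_eq_square)
      finally show ?thesis by (simp add: algebra_simps)
    qed
    note q = this
    define d where "d = inner x z - g x"
    have "d\<^sup>2 \<le> 0"
    proof (cases "x = 0")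
      case False
      define n where "n = (norm x)\<^sup>2"
      have n: "n > 0" using False by (simp add: n_def)
      \<comment> \<open>The value \<open>t = - d / n\<close> is the minimum point of the
        quadratic.\<close>
      have "0 \<le> (- d / n) * (2 * d) + (- d / n)\<^sup>2 * n" using q[of "- d / n"] by (simp add: d_def n_def)
      also have "\<dots> = - (d\<^sup>2 / n)" using n by (simp add: field_simps power2_eq_square)
      finally show ?thesis using n by (simp add: field_simps)
    qed (simp add: d_def g.zero)
    then show ?thesis by (simp add: d_def)
  qed
  with zK show ?thesis by blast
qed

section \<open>Closed subspaces and orthogonal projections\<close>

lemma hilbert_subspace: assumes "hilbert K" shows "subspace K" "closed K"
  using assms by (auto simp: hilbert_def subspace_def scaleR_scaleC)

lemma hilbert_diff: "hilbert K \<Longrightarrow> x \<in> K \<Longrightarrow> y \<in> K \<Longrightarrow> x - y \<in> K"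
  by (simp add: hilbert_subspace subspace_diff)

lemma hilbert_UNIV: "hilbert UNIV"
  by (simp add: hilbert_def)

text \<open>The real functional \<open>inner x\<close> is represented on \<open>K\<close> by some
  \<open>p\<close>; invariance of \<open>K\<close> under multiplication by \<open>\<i>\<close> turns
  the real orthogonality of \<open>x - p\<close> into complex orthogonality.\<close>

lemma hilbert_projection:
  assumes K: "hilbert K"
  obtains p where "p \<in> K" "\<And>y. y \<in> K \<Longrightarrow> cinner (x - p) y = 0"
proof -
  obtain p where p: "p \<in> K" "\<And>y. y \<in> K \<Longrightarrow> inner x y = inner y p"
    using riesz_real[OF hilbert_subspace[OF K] bounded_linear_inner_right[of x]] by blast
  have "inner (x - p) y = 0" if "y \<in> K" for y
    using p(2)[OF that] by (simp add: inner_diff_left inner_commute[of y p])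
  moreover have "\<i> *\<^sub>C y \<in> K" if "y \<in> K" for y using K that by (simp add: hilbert_def)
  ultimately have "cinner (x - p) y = 0" if "y \<in> K" for y
    using that by (simp add: cinner_eq_inner complex_eq_iff)
  with p(1) show thesis by (rule that)
qed

lemma hilbert_eq_UNIV:
  assumes K: "hilbert K" and total: "\<And>x. (\<And>y. y \<in> K \<Longrightarrow> cinner x y = 0) \<Longrightarrow> x = 0"
  shows "K = UNIV"
proof -
  have "x \<in> K" for x
  proof -
    obtain p where p: "p \<in> K" "\<And>y. y \<in> K \<Longrightarrow> cinner (x - p) y = 0"
      using hilbert_projection[OF K] by blast
    then show ?thesis using total[of "x - p"] by simp
  qed
  then show ?thesis by blast
qed

section \<open>Adjoints\<close>

abbreviation dag :: "('a::chilbert_space \<Rightarrow> 'b::chilbert_space) \<Rightarrow> 'b \<Rightarrow> 'a" where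
  "dag A \<equiv> adj UNIV UNIV A"

lemma riesz:
  assumes f: "bounded_linear f" "\<And>c x. f (c *\<^sub>C x) = c * f x"
  shows "\<exists>z::'a::chilbert_space. \<forall>x. f x = cinner x z"
proof -
  have "bounded_linear (\<lambda>x. Re (f x))"
    using bounded_linear_compose[OF bounded_linear_Re f(1)] .
  then obtain z where z: "\<And>x. Re (f x) = inner x z"
    using riesz_real[of UNIV "\<lambda>x. Re (f x)"] by auto
  have "f x = cinner x z" for x
  proof (rule complex_eqI)
    have "Im (f x) = - Re (f (\<i> *\<^sub>C x))" by (simp add: f(2))
    also have "\<dots> = - Re (cinner (\<i> *\<^sub>C x) z)" by (simp only: z Re_cinner)
    also have "\<dots> = Im (cinner x z)" by (simp add: cinner_scaleC_left)
    finally show "Im (f x) = Im (cinner x z)" .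
  qed (simp add: z Re_cinner)
  then show ?thesis by blast
qed

lemma adjoint_exists:
  assumes A: "clin (A :: 'a::chilbert_space \<Rightarrow> 'b::chilbert_space)"
  shows "\<exists>B. clin B \<and> (\<forall>x y. cinner (A x) y = cinner x (B y))"
proof -
  have "\<exists>z. \<forall>x. cinner (A x) y = cinner x z" for y
  proof (rule riesz)
    show "bounded_linear (\<lambda>x. cinner (A x) y)"
    proof (rule bounded_linear_intro)
      fix x z r
      show "cinner (A (x + z)) y = cinner (A x) y + cinner (A z) y"
        by (simp add: clin_add[OF A] cinner_add_left)
      show "cinner (A (r *\<^sub>R x)) y = r *\<^sub>R cinner (A x) y"
        by (simp add: scaleR_scaleC[of r x] clin_scaleC[OF A] cinner_scaleC_left scaleR_conv_of_real)
      obtain M where "\<And>x. norm (A x) \<le> M * norm x" using clin_bound[OF A] by blast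
      then have "norm (A x) * norm y \<le> (onorm A * norm x) * norm y"
        by (intro mult_right_mono onorm clin_bounded_linear A) auto
      then show "norm (cinner (A x) y) \<le> norm x * (onorm A * norm y)"
        using norm_cinner_le[of "A x" y] by (simp add: algebra_simps)
    qed
    show "cinner (A (c *\<^sub>C x)) y = c * cinner (A x) y" for c x
      by (simp add: clin_scaleC[OF A] cinner_scaleC_left)
  qed
  then obtain B where B: "\<And>x y. cinner (A x) y = cinner x (B y)" by metis
  have B': "cinner (B y) x = cinner y (A x)" for x y
    using arg_cong[OF B[of x y], of cnj] by (simp add: cnj_cinner)
  have "clin B"
    unfolding bounded_ops_UNIV[symmetric] bounded_ops_def
  proof (intro CollectI conjI ballI allI)
    show "B (x + y) = B x + B y" for x y
      by (rule cinner_ext) (simp add: B' cinner_add_left)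
    show "B (c *\<^sub>C x) = c *\<^sub>C B x" for c x
      by (rule cinner_ext) (simp add: B' cinner_scaleC_left)
    obtain M where M: "M > 0" "\<And>x. norm (A x) \<le> M * norm x" using clin_bound[OF A] by blast
    have "norm (B y) \<le> M * norm y" for y
    proof -
      have "(norm (B y))\<^sup>2 = inner (A (B y)) y"
        by (simp add: power2_norm_eq_inner inner_cinner B)
      also have "\<dots> \<le> norm (A (B y)) * norm y" by (rule norm_cauchy_schwarz)
      also have "\<dots> \<le> M * norm (B y) * norm y" by (intro mult_right_mono M) simp
      finally show ?thesis using M(1) by (cases "B y = 0") (auto simp: power2_eq_square)
    qed
    then show "\<exists>M. \<forall>x\<in>UNIV. norm (B x) \<le> M * norm x" by blast
  qed simp
  then show ?thesis using B by blast
qed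

text \<open>Since \<open>adj\<close> is a choice, existence of some adjoint is what gives it its
  defining property.\<close>

lemma dag_exists:
  assumes A: "clin A"
  shows "clin (dag A) \<and> (\<forall>x y. cinner (A x) y = cinner x (dag A y))"
proof -
  define P where "P = (\<lambda>B. B \<in> bounded_ops UNIV UNIV \<and>
    (\<forall>x\<in>UNIV. \<forall>y\<in>UNIV. cinner (A x) y = cinner x (B y)))"
  have "\<exists>B. P B" using adjoint_exists[OF A] by (simp add: P_def bounded_ops_UNIV)
  then have "P (SOME B. P B)" by (rule someI_ex)
  moreover have "dag A = (SOME B. P B)" by (simp only: adj_def P_def)
  ultimately have "P (dag A)" by (simp only:)
  then show ?thesis unfolding P_def bounded_ops_UNIV by blast
qed

lemma clin_dag: "clin A \<Longrightarrow> clin (dag A)"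
  using dag_exists by blast

lemma cinner_dag: "clin A \<Longrightarrow> cinner (A x) y = cinner x (dag A y)"
  using dag_exists by blast

lemma cinner_dag': "clin A \<Longrightarrow> cinner (dag A x) y = cinner x (A y)"
  using arg_cong[OF cinner_dag[of A y x], of cnj] by (simp add: cnj_cinner)

lemma dag_unique:
  assumes "clin A" "\<And>x y. cinner (A x) y = cinner x (B y)" shows "dag A = B"
proof
  show "dag A y = B y" for y
  proof (rule cinner_ext)
    show "cinner (dag A y) x = cinner (B y) x" for x
      using arg_cong[OF assms(2)[of x y], of cnj] by (simp add: cnj_cinner cinner_dag' assms(1))
  qed
qed

text \<open>Polarisation yields the real parts; the imaginary parts are real parts with
  \<open>y\<close> replaced by \<open>\<i> *\<^sub>C y\<close>.\<close>

lemma norm_eq_imp_cinner_eq: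
  assumes A: "clin A" and B: "clin B" and eq: "\<And>x. norm (A x) = norm (B x)"
  shows "cinner (A x) (A y) = cinner (B x) (B y)"
proof -
  have re: "inner (A x) (A y) = inner (B x) (B y)" for x y
  proof -
    have "norm (A x + A y) = norm (B x + B y)"
      using eq[of "x + y"] by (simp add: clin_add[OF A] clin_add[OF B])
    then show ?thesis by (simp add: dot_norm eq)
  qed
  show ?thesis
    using re[of x y] re[of x "\<i> *\<^sub>C y"] by (simp add: cinner_eq_inner clin_scaleC[OF A] clin_scaleC[OF B])
qed

lemma clin_ident: "clin (\<lambda>x. x)"
  by (simp add: clin_def bounded_linear_ident)

lemma isometry_cinner:
  assumes A: "clin A" and iso: "\<And>x. norm (A x) = norm x"
  shows "cinner (A x) (A y) = cinner x y"
  using norm_eq_imp_cinner_eq[OF A clin_ident iso] .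

lemma isometry_iff_dag:
  assumes A: "clin A"
  shows "(\<forall>x. dag A (A x) = x) \<longleftrightarrow> (\<forall>x. norm (A x) = norm x)"
proof safe
  fix x assume "\<forall>x. dag A (A x) = x"
  then have "complex_of_real ((norm (A x))\<^sup>2) = complex_of_real ((norm x)\<^sup>2)"
    by (simp only: cinner_self[symmetric] cinner_dag[OF A])
  then show "norm (A x) = norm x" by (simp only: of_real_eq_iff) (simp add: power2_eq_iff_nonneg)
next
  fix x assume "\<forall>x. norm (A x) = norm x"
  then have iso: "\<And>x. norm (A x) = norm x" by blast
  show "dag A (A x) = x"
    by (rule cinner_ext) (simp add: cinner_dag'[OF A] isometry_cinner[OF A iso])
qed

section \<open>Orthonormal bases and dimension\<close>

lemma cmod_cinner_commute: "cmod (cinner x y) = cmod (cinner y (x::'a::complex_inner))"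
  by (subst cinner_commute) simp

definition orth :: "'a::complex_inner set \<Rightarrow> 'a set" where
  "orth M = {x. \<forall>m\<in>M. cinner x m = 0}"

lemma orthI: "(\<And>m. m \<in> M \<Longrightarrow> cinner x m = 0) \<Longrightarrow> x \<in> orth M"
  by (simp add: orth_def)

lemma orthD: "x \<in> orth M \<Longrightarrow> m \<in> M \<Longrightarrow> cinner x m = 0"
  by (simp add: orth_def)

lemma orthD': "x \<in> orth M \<Longrightarrow> m \<in> M \<Longrightarrow> cinner m x = 0"
  by (simp add: orth_def cinner_eq_zero_commute[of m])

lemma hilbert_orth: "hilbert (orth M)"
proof -
  have "orth M = (\<Inter>m\<in>M. {x. cinner x m = 0})" by (auto simp: orth_def)
  moreover have "closed {x. cinner x m = 0}" for m :: 'a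
    by (intro closed_Collect_eq continuous_intros)
  ultimately have "closed (orth M)" by (simp add: closed_INT)
  then show ?thesis by (auto simp: hilbert_def orth_def cinner_add_left cinner_scaleC_left)
qed

lemma orth_decompose:
  assumes "hilbert K" obtains p q where "p \<in> K" "q \<in> orth K" "x = p + q"
proof -
  obtain p where "p \<in> K" "\<And>y. y \<in> K \<Longrightarrow> cinner (x - p) y = 0"
    using hilbert_projection[OF assms] by blast
  then show thesis using that[of p "x - p"] by (simp add: orth_def)
qed

definition orthonormal :: "'a::complex_inner set \<Rightarrow> bool" where
  "orthonormal B \<longleftrightarrow> (\<forall>b\<in>B. \<forall>b'\<in>B. cinner b b' = (if b = b' then 1 else 0))"

lemma orthonormal_subset: "orthonormal B \<Longrightarrow> F \<subseteq> B \<Longrightarrow> orthonormal F"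
  unfolding orthonormal_def by blast

lemma orthonormal_norm: assumes "orthonormal B" "b \<in> B" shows "norm b = 1"
proof -
  have "complex_of_real ((norm b)\<^sup>2) = complex_of_real 1"
    unfolding cinner_self[symmetric] using assms by (simp add: orthonormal_def)
  then have "(norm b)\<^sup>2 = 1" by (simp only: of_real_eq_iff)
  then show ?thesis by (simp add: power2_eq_1_iff) (use norm_ge_zero[of b] in linarith)
qed

lemma orthonormal_basis_iff:
  "orthonormal_basis K B \<longleftrightarrow> B \<subseteq> K \<and> orthonormal B \<and> (\<forall>x\<in>K. (\<forall>b\<in>B. cinner x b = 0) \<longrightarrow> x = 0)"
  by (simp add: orthonormal_basis_def orthonormal_def)

text \<open>By Zorn there is a maximal orthonormal subset of \<open>K\<close>; a nonzero vector of
  \<open>K\<close> orthogonal to it could be normalised and added.\<close>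

lemma orthonormal_basis_exists:
  assumes K: "hilbert K"
  shows "\<exists>B. orthonormal_basis K B"
proof -
  define \<A> where "\<A> = {B. B \<subseteq> K \<and> orthonormal B}"
  have "\<Union>\<C> \<in> \<A>" if chain: "subset.chain \<A> \<C>" for \<C>
  proof -
    have "\<C> \<subseteq> \<A>" using chain by (simp add: subset.chain_def)
    moreover have "orthonormal (\<Union>\<C>)"
      unfolding orthonormal_def
    proof (intro ballI)
      fix b b' assume "b \<in> \<Union>\<C>" "b' \<in> \<Union>\<C>"
      then obtain X Y where XY: "X \<in> \<C>" "Y \<in> \<C>" "b \<in> X" "b' \<in> Y" by blast
      have "X \<subseteq> Y \<or> Y \<subseteq> X" using chain XY(1,2) by (auto simp: subset_chain_def)
      then obtain Z where "Z \<in> \<C>" "b \<in> Z" "b' \<in> Z" using XY by blast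
      moreover from this have "orthonormal Z" using \<open>\<C> \<subseteq> \<A>\<close> by (auto simp: \<A>_def)
      ultimately show "cinner b b' = (if b = b' then 1 else 0)" by (simp add: orthonormal_def)
    qed
    ultimately show ?thesis by (auto simp: \<A>_def)
  qed
  then obtain B where B: "B \<in> \<A>" "\<And>X. X \<in> \<A> \<Longrightarrow> B \<subseteq> X \<Longrightarrow> X = B"
    using subset_Zorn'[of \<A>] by blast
  have "x = 0" if x: "x \<in> K" "\<forall>b\<in>B. cinner x b = 0" for x
  proof (rule ccontr)
    assume "x \<noteq> 0"
    define e where "e = complex_of_real (inverse (norm x)) *\<^sub>C x"
    have "norm e = 1" using \<open>x \<noteq> 0\<close> by (simp add: e_def norm_scaleC norm_inverse)
    then have ee: "cinner e e = 1" by (simp add: cinner_self)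
    have eb: "cinner e b = 0" "cinner b e = 0" if "b \<in> B" for b
      using x(2) that by (simp_all add: e_def cinner_scaleC_left cinner_scaleC_right cinner_eq_zero_commute[of b])
    have "e \<in> K" using x(1) K by (simp add: e_def hilbert_def)
    then have "insert e B \<in> \<A>" using B(1) ee eb by (auto simp: \<A>_def orthonormal_def)
    then have "e \<in> B" using B(2) by blast
    with eb ee show False by fastforce
  qed
  then show ?thesis using B(1) by (auto simp: orthonormal_basis_iff \<A>_def)
qed

lemma orthonormal_cinner_sum:
  assumes "orthonormal F" "finite F" "b \<in> F"
  shows "cinner (\<Sum>f\<in>F. c f *\<^sub>C f) b = c b"
proof -
  have "cinner (\<Sum>f\<in>F. c f *\<^sub>C f) b = (\<Sum>f\<in>F. if f = b then c f else 0)"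
    unfolding cinner_sum_left
    using assms by (intro sum.cong) (auto simp: cinner_scaleC_left orthonormal_def)
  then show ?thesis using assms by simp
qed

lemma orthonormal_norm_sum:
  assumes F: "orthonormal F" "finite F"
  shows "(norm (\<Sum>f\<in>F. c f *\<^sub>C f))\<^sup>2 = (\<Sum>f\<in>F. (cmod (c f))\<^sup>2)"
proof -
  let ?p = "\<Sum>f\<in>F. c f *\<^sub>C f"
  have "complex_of_real ((norm ?p)\<^sup>2) = cinner ?p ?p" by (simp add: cinner_self)
  also have "\<dots> = (\<Sum>f\<in>F. cnj (c f) * cinner ?p f)"
    using cinner_sum_right[of ?p "\<lambda>f. c f *\<^sub>C f" F] by (simp only: cinner_scaleC_right)
  also have "\<dots> = (\<Sum>f\<in>F. cnj (c f) * c f)" using F by (intro sum.cong) (auto simp: orthonormal_cinner_sum)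
  also have "\<dots> = complex_of_real (\<Sum>f\<in>F. (cmod (c f))\<^sup>2)"
    by (simp only: of_real_sum complex_norm_square mult.commute)
  finally show ?thesis by (simp only: of_real_eq_iff)
qed

lemma bessel:
  assumes F: "orthonormal F" "finite F"
  shows "(\<Sum>f\<in>F. (cmod (cinner x f))\<^sup>2) \<le> (norm x)\<^sup>2"
proof -
  define p where "p = (\<Sum>f\<in>F. cinner x f *\<^sub>C f)"
  have "cinner (x - p) f = 0" if "f \<in> F" for f
    using that F by (simp add: p_def cinner_diff_left orthonormal_cinner_sum)
  then have "cinner (x - p) p = 0" 
    using cinner_sum_right[of "x - p" "\<lambda>f. cinner x f *\<^sub>C f" F]
    by (simp add: p_def[symmetric] cinner_scaleC_right)
  from norm_add_orthogonal[OF this] have "(norm p)\<^sup>2 \<le> (norm x)\<^sup>2" by simp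
  then show ?thesis using orthonormal_norm_sum[OF F] by (simp add: p_def)
qed

lemma finite_basis_expansion:
  assumes B: "orthonormal_basis K B" "finite B" and K: "hilbert K" "x \<in> K"
  shows "x = (\<Sum>b\<in>B. cinner x b *\<^sub>C b)"
proof -
  let ?p = "\<Sum>b\<in>B. cinner x b *\<^sub>C b"
  have B': "orthonormal B" "B \<subseteq> K" using B by (auto simp: orthonormal_basis_iff)
  have "?p \<in> K" using K(1) B'(2)
    by (intro subspace_sum hilbert_subspace) (auto simp: hilbert_def)
  then have "x - ?p \<in> K" using K by (simp add: hilbert_diff)
  moreover have "\<forall>b\<in>B. cinner (x - ?p) b = 0"
    using B' B(2) by (simp add: cinner_diff_left orthonormal_cinner_sum)
  ultimately have "x - ?p = 0" using B(1) unfolding orthonormal_basis_iff by blast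
  then show ?thesis by simp
qed

lemma parseval:
  assumes B: "orthonormal_basis K B" "finite B" and K: "hilbert K" "x \<in> K"
  shows "(norm x)\<^sup>2 = (\<Sum>b\<in>B. (cmod (cinner x b))\<^sup>2)"
  using orthonormal_norm_sum[of B "cinner x"] finite_basis_expansion[OF assms] B
  by (simp add: orthonormal_basis_iff)

section \<open>Cardinalities of orthonormal sets\<close>

text \<open>By Bessel at most \<open>(norm x)\<^sup>2 * Suc n\<close> elements have a squared
  coefficient above \<open>1 / Suc n\<close>, so the support is a countable union of finite
  sets.\<close>

lemma countable_orthonormal_support:
  assumes B: "orthonormal B"
  shows "countable {b\<in>B. cinner x b \<noteq> 0}"
proof -
  define A where "A n = {b\<in>B. (cmod (cinner x b))\<^sup>2 > 1 / Suc n}" for n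
  have "finite (A n)" for n
  proof (rule ccontr)
    assume "infinite (A n)"
    obtain k :: nat where k: "(norm x)\<^sup>2 * Suc n < k" using reals_Archimedean2 by blast
    obtain F where F: "F \<subseteq> A n" "finite F" "card F = k"
      using infinite_arbitrarily_large[OF \<open>infinite (A n)\<close>] by blast
    have "orthonormal F" using orthonormal_subset[OF B] F(1) by (auto simp: A_def)
    have "k * (1 / Suc n) = (\<Sum>f\<in>F. 1 / Suc n)" using F(3) by simp
    also have "\<dots> \<le> (\<Sum>f\<in>F. (cmod (cinner x f))\<^sup>2)"
      using F(1) by (intro sum_mono) (auto simp: A_def intro: less_imp_le)
    also have "\<dots> \<le> (norm x)\<^sup>2" by (rule bessel[OF \<open>orthonormal F\<close> F(2)])
    finally show False using k by (simp add: field_simps)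
  qed
  moreover have "{b\<in>B. cinner x b \<noteq> 0} \<subseteq> (\<Union>n. A n)"
  proof
    fix b assume b: "b \<in> {b\<in>B. cinner x b \<noteq> 0}"
    then have "(cmod (cinner x b))\<^sup>2 > 0" by simp
    then obtain n where "inverse (real (Suc n)) < (cmod (cinner x b))\<^sup>2"
      using reals_Archimedean by blast
    with b show "b \<in> (\<Union>n. A n)" by (auto simp: A_def inverse_eq_divide)
  qed
  ultimately show ?thesis
    by (meson countable_UN countable_finite countable_subset countableI_type)
qed

text \<open>The counting principle behind all infinite dimension comparisons below. Each
  \<open>f\<close> chooses a vector \<open>d\<close> that is not orthogonal to it, and any one
  \<open>d\<close> is chosen only countably often; the injection records \<open>d\<close> and the
  position of \<open>f\<close> in an enumeration of the support of \<open>d\<close>.\<close>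

lemma card_orthonormal_le_times_nat:
  assumes F: "orthonormal F" and D: "\<And>f. f \<in> F \<Longrightarrow> \<exists>d\<in>D. cinner d f \<noteq> 0"
  shows "|F| \<le>o |D \<times> (UNIV::nat set)|"
proof -
  obtain d where d: "\<And>f. f \<in> F \<Longrightarrow> d f \<in> D \<and> cinner (d f) f \<noteq> 0" using D by metis
  define A where "A x = {f\<in>F. cinner x f \<noteq> 0}" for x
  have c: "countable (A x)" for x using countable_orthonormal_support[OF F] by (simp add: A_def)
  have "inj_on (\<lambda>f. (d f, to_nat_on (A (d f)) f)) F"
  proof (rule inj_onI)
    fix f g assume fg: "f \<in> F" "g \<in> F"
      and eq: "(d f, to_nat_on (A (d f)) f) = (d g, to_nat_on (A (d g)) g)"
    have "d f = d g" using eq by simp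
    moreover from this have "f \<in> A (d f)" "g \<in> A (d f)" using d[of f] d[of g] fg by (auto simp: A_def)
    ultimately show "f = g" using eq inj_on_to_nat_on[OF c, of "d f"] by (auto dest: inj_onD)
  qed
  moreover have "(\<lambda>f. (d f, to_nat_on (A (d f)) f)) ` F \<subseteq> D \<times> UNIV" using d by auto
  ultimately show ?thesis unfolding card_of_ordLeq[symmetric] by blast
qed

lemma card_of_times_nat: "infinite A \<Longrightarrow> |A \<times> (UNIV::nat set)| =o |A|"
  by (simp add: card_of_Times_infinite infinite_iff_card_of_nat)

text \<open>For infinite \<open>D\<close> every \<open>b\<close> meets some \<open>d\<close>, and
  the counting principle applies. For finite \<open>D\<close> the numbers
  \<open>(cmod (cinner f d))\<^sup>2\<close> are summed in both orders: Parseval makes the sum equal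
  to \<open>card F\<close>, Bessel bounds it by \<open>card D\<close>.\<close>

lemma card_orthonormal_le_basis:
  assumes D: "orthonormal_basis K D" and K: "hilbert K" and B: "orthonormal B" "B \<subseteq> K"
  shows "|B| \<le>o |D|"
proof (cases "finite D")
  case False
  have "\<exists>d\<in>D. cinner d b \<noteq> 0" if "b \<in> B" for b
  proof (rule ccontr)
    assume "\<not> ?thesis"
    then have "\<forall>d\<in>D. cinner b d = 0" using cinner_eq_zero_commute[of b] by blast
    then have "b = 0" using D B that by (auto simp: orthonormal_basis_iff)
    then show False using orthonormal_norm[OF B(1) that] by simp
  qed
  then have "|B| \<le>o |D \<times> (UNIV::nat set)|" by (rule card_orthonormal_le_times_nat[OF B(1)])
  then show ?thesis using card_of_times_nat[OF False] by (rule ordLeq_ordIso_trans)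
next
  case True
  have D': "orthonormal D" using D by (simp add: orthonormal_basis_iff)
  have *: "card F \<le> card D" if F: "F \<subseteq> B" "finite F" for F
  proof -
    have oF: "orthonormal F" using orthonormal_subset[OF B(1) F(1)] .
    have "real (card F) = (\<Sum>f\<in>F. (norm f)\<^sup>2)" using orthonormal_norm[OF oF] by simp
    also have "\<dots> = (\<Sum>f\<in>F. \<Sum>d\<in>D. (cmod (cinner f d))\<^sup>2)"
      using F B by (intro sum.cong refl parseval[OF D True K]) auto
    also have "\<dots> = (\<Sum>d\<in>D. \<Sum>f\<in>F. (cmod (cinner f d))\<^sup>2)" by (rule sum.swap)
    also have "\<dots> = (\<Sum>d\<in>D. \<Sum>f\<in>F. (cmod (cinner d f))\<^sup>2)"
      by (rule sum.cong[OF refl], rule sum.cong[OF refl]) (simp only: cmod_cinner_commute)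
    also have "\<dots> \<le> (\<Sum>d\<in>D. (norm d)\<^sup>2)" by (intro sum_mono bessel oF F)
    also have "\<dots> = real (card D)" using orthonormal_norm[OF D'] by simp
    finally show ?thesis by simp
  qed
  have "finite B"
  proof (rule ccontr)
    assume "infinite B"
    then obtain F where "F \<subseteq> B" "finite F" "card F = Suc (card D)"
      using infinite_arbitrarily_large by blast
    with *[of F] show False by simp
  qed
  then have "\<exists>f. f ` B \<subseteq> D \<and> inj_on f B" using card_le_inj[OF _ True] * by blast
  then show ?thesis unfolding card_of_ordLeq[symmetric] by blast
qed

lemma hdim_ordIso:
  assumes "orthonormal_basis K B" "hilbert K" shows "hdim K =o |B|"
proof -
  have "orthonormal_basis K (SOME B. orthonormal_basis K B)" using assms(1) by (rule someI)
  moreover have "|A| \<le>o |C|" if "orthonormal_basis K A" "orthonormal_basis K C" for A C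
    using card_orthonormal_le_basis[OF that(2) assms(2), of A] that(1)
    by (simp add: orthonormal_basis_iff)
  ultimately have "|SOME B. orthonormal_basis K B| =o |B|"
    unfolding ordIso_iff_ordLeq using assms(1) by blast
  then show ?thesis by (simp add: hdim_def)
qed

section \<open>Extending operators from total sets\<close>

lemma hilbert_closure:
  assumes "0 \<in> M" "\<And>x y. x \<in> M \<Longrightarrow> y \<in> M \<Longrightarrow> x + y \<in> M" "\<And>c x. x \<in> M \<Longrightarrow> c *\<^sub>C x \<in> M"
  shows "hilbert (closure M)"
  unfolding hilbert_def
proof (intro conjI ballI allI)
  show "0 \<in> closure M" using assms(1) closure_subset by blast
  show "x + y \<in> closure M" if xy: "x \<in> closure M" "y \<in> closure M" for x y
  proof -
    obtain a where a: "\<And>n. a n \<in> M" "a \<longlonglongrightarrow> x"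
      using xy(1) unfolding closure_sequential by blast
    obtain b where b: "\<And>n. b n \<in> M" "b \<longlonglongrightarrow> y"
      using xy(2) unfolding closure_sequential by blast
    from a b have "\<And>n. a n + b n \<in> M" "(\<lambda>n. a n + b n) \<longlonglongrightarrow> x + y"
      using assms(2) by (auto intro: tendsto_add)
    then show ?thesis unfolding closure_sequential by (intro exI[of _ "\<lambda>n. a n + b n"]) blast
  qed
  show "c *\<^sub>C x \<in> closure M" if "x \<in> closure M" for c x
  proof -
    have "(\<lambda>x. c *\<^sub>C x) ` closure M \<subseteq> closure M"
      using assms(3) closure_subset[of M]
      by (intro image_closure_subset continuous_intros) auto
    then show ?thesis using that by blast
  qed
qed auto

lemma closure_eq_UNIV:
  fixes M :: "'a::chilbert_space set"
  assumes "0 \<in> M" "\<And>x y. x \<in> M \<Longrightarrow> y \<in> M \<Longrightarrow> x + y \<in> M" "\<And>c x. x \<in> M \<Longrightarrow> c *\<^sub>C x \<in> M"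
    and "\<And>x. x \<in> orth M \<Longrightarrow> x = 0"
  shows "closure M = UNIV"
  using hilbert_closure[OF assms(1-3)]
proof (rule hilbert_eq_UNIV)
  fix x assume "\<And>y. y \<in> closure M \<Longrightarrow> cinner x y = 0"
  then have "x \<in> orth M" using closure_subset by (intro orthI) blast
  then show "x = 0" by (rule assms(4))
qed

text \<open>Here \<open>span\<close> is the real span in the product, so closure under complex
  scalars has to be inherited from the generators.\<close>

lemma span_pair_scaleC:
  fixes S :: "('a::complex_inner \<times> 'b::complex_inner) set"
  assumes S: "\<And>x y. (x, y) \<in> S \<Longrightarrow> (c *\<^sub>C x, c *\<^sub>C y) \<in> S" and "(x, y) \<in> span S"
  shows "(c *\<^sub>C x, c *\<^sub>C y) \<in> span S"
proof -
  let ?c = "\<lambda>p. (c *\<^sub>C fst p, c *\<^sub>C snd p) :: 'a \<times> 'b"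
  have "linear ?c"
    by (rule linearI)
      (simp_all add: scaleC_add_right bounded_linear.linear[OF bounded_linear_scaleC, THEN linear_scale])
  then have "?c ` span S = span (?c ` S)" by (rule linear_span_image[symmetric])
  also have "\<dots> \<subseteq> span S" using S by (intro span_mono) auto
  finally show ?thesis using assms(2) by force
qed

lemma fst_image_subspace:
  fixes G :: "('a::complex_inner \<times> 'b::complex_inner) set"
  assumes G: "subspace G" and scale: "\<And>c x y. (x, y) \<in> G \<Longrightarrow> (c *\<^sub>C x, c *\<^sub>C y) \<in> G"
  shows "0 \<in> fst ` G" "u \<in> fst ` G \<Longrightarrow> v \<in> fst ` G \<Longrightarrow> u + v \<in> fst ` G"
    "u \<in> fst ` G \<Longrightarrow> c *\<^sub>C u \<in> fst ` G"
proof -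
  show "0 \<in> fst ` G" using imageI[OF subspace_0[OF G], of fst] by simp
  show "u + v \<in> fst ` G" if uv: "u \<in> fst ` G" "v \<in> fst ` G"
  proof -
    obtain p q where "p \<in> G" "q \<in> G" "u = fst p" "v = fst q" using uv by blast
    then show ?thesis using imageI[OF subspace_add[OF G], of p q fst] by simp
  qed
  show "c *\<^sub>C u \<in> fst ` G" if u: "u \<in> fst ` G"
  proof -
    obtain y where "(u, y) \<in> G" using u by force
    then show ?thesis using imageI[OF scale, of u y fst c] by simp
  qed
qed

text \<open>The closure of the graph \<open>G\<close> is again the graph of a function, now defined everywhere.\<close>

lemma dense_graph_extension:
  fixes G :: "('a::chilbert_space \<times> 'b::chilbert_space) set"
  assumes G: "subspace G" "\<And>c x y. (x, y) \<in> G \<Longrightarrow> (c *\<^sub>C x, c *\<^sub>C y) \<in> G"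
    and bd: "\<And>x y. (x, y) \<in> G \<Longrightarrow> norm y \<le> M * norm x"
    and dense: "closure (fst ` G) = UNIV"
  shows "\<exists>T. clin T \<and> (\<forall>(x, y)\<in>G. T x = y)"
proof -
  define H where "H = closure G"
  have "closure G \<subseteq> {p. norm (snd p) \<le> M * norm (fst p)}"
    using bd by (intro closure_minimal closed_Collect_le continuous_intros) auto
  then have bdH: "norm y \<le> M * norm x" if "(x, y) \<in> H" for x y using that by (auto simp: H_def)
  have addH: "(x + x', y + y') \<in> H" if H: "(x, y) \<in> H" "(x', y') \<in> H" for x x' y y'
  proof -
    obtain a where a: "\<And>n. a n \<in> G" "a \<longlonglongrightarrow> (x, y)"
      using H(1) unfolding H_def closure_sequential by blast
    obtain b where b: "\<And>n. b n \<in> G" "b \<longlonglongrightarrow> (x', y')"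
      using H(2) unfolding H_def closure_sequential by blast
    note ab = a b
    have "\<And>n. a n + b n \<in> G" using ab G(1) by (simp add: subspace_add)
    moreover have "(\<lambda>n. a n + b n) \<longlonglongrightarrow> (x, y) + (x', y')" using ab by (intro tendsto_add)
    ultimately show ?thesis unfolding H_def closure_sequential
      by (intro exI[of _ "\<lambda>n. a n + b n"]) simp
  qed
  have scaleH: "(c *\<^sub>C x, c *\<^sub>C y) \<in> H" if "(x, y) \<in> H" for x y c
  proof -
    have "(\<lambda>p. (c *\<^sub>C fst p, c *\<^sub>C snd p)) ` closure G \<subseteq> closure G"
      using G(2) closure_subset[of G]
      by (intro image_closure_subset continuous_intros) auto
    then show ?thesis using that by (auto simp: H_def)
  qed
  have unique: "y = y'" if "(x, y) \<in> H" "(x, y') \<in> H" for x y y'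
  proof -
    have "(-1) *\<^sub>C x = - x" "(-1) *\<^sub>C y' = - y'"
      using scaleR_scaleC[of "-1" x] scaleR_scaleC[of "-1" y'] by simp_all
    then show ?thesis using bdH[OF addH[OF that(1) scaleH[OF that(2), of "-1"]]] by simp
  qed
  have "\<exists>y. (x, y) \<in> H" for x
  proof -
    have "x \<in> closure (fst ` G)" using dense by simp
    then obtain a where a: "\<And>n. a n \<in> fst ` G" "a \<longlonglongrightarrow> x" unfolding closure_sequential by blast
    have "\<forall>n. \<exists>y. (a n, y) \<in> G" using a(1) by force
    then obtain b where b: "\<And>n. (a n, b n) \<in> G" by metis
    have "Cauchy a" using a(2) LIMSEQ_imp_Cauchy by blast
    have "Cauchy b"
    proof (rule metric_CauchyI)
      fix e :: real assume "e > 0"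
      then have "e / (\<bar>M\<bar> + 1) > 0" by (simp add: add_nonneg_pos)
      then obtain N where N: "\<And>m n. m \<ge> N \<Longrightarrow> n \<ge> N \<Longrightarrow> dist (a m) (a n) < e / (\<bar>M\<bar> + 1)"
        using \<open>Cauchy a\<close> unfolding Cauchy_def by metis
      have "dist (b m) (b n) < e" if "m \<ge> N" "n \<ge> N" for m n
      proof -
        have "(a m, b m) - (a n, b n) \<in> G" using b G(1) by (intro subspace_diff)
        then have "norm (b m - b n) \<le> M * norm (a m - a n)" using bd by simp
        also have "\<dots> \<le> (\<bar>M\<bar> + 1) * norm (a m - a n)" by (intro mult_right_mono) auto
        also have "\<dots> < e"
          using N[OF that] by (simp add: dist_norm field_simps add_nonneg_pos)
        finally show ?thesis by (simp add: dist_norm)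
      qed
      then show "\<exists>N. \<forall>m\<ge>N. \<forall>n\<ge>N. dist (b m) (b n) < e" by blast
    qed
    then obtain y where "b \<longlonglongrightarrow> y" using Cauchy_convergent convergent_def by blast
    with a(2) have "(\<lambda>n. (a n, b n)) \<longlonglongrightarrow> (x, y)" by (rule tendsto_Pair)
    with b have "(x, y) \<in> H" unfolding H_def closure_sequential
      by (intro exI[of _ "\<lambda>n. (a n, b n)"]) simp
    then show ?thesis by blast
  qed
  then obtain T where T: "\<And>x. (x, T x) \<in> H" by metis
  have "clin T"
    unfolding bounded_ops_UNIV[symmetric] bounded_ops_def
  proof (intro CollectI conjI ballI allI)
    show "T (x + y) = T x + T y" for x y using unique[OF T addH[OF T T]] .
    show "T (c *\<^sub>C x) = c *\<^sub>C T x" for c x using unique[OF T scaleH[OF T]] .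
    show "\<exists>M. \<forall>x\<in>UNIV. norm (T x) \<le> M * norm x" using bdH[OF T] by blast
  qed simp
  moreover have "T x = y" if "(x, y) \<in> G" for x y
    using unique[OF T] that closure_subset by (auto simp: H_def)
  ultimately show ?thesis by blast
qed

text \<open>Setting the operator to zero on the orthogonal complement of its domain makes the domain
  dense, and by Pythagoras it remains a contraction.\<close>

lemma graph_extension:
  fixes G :: "('a::chilbert_space \<times> 'b::chilbert_space) set"
  assumes G: "subspace G" "\<And>c x y. (x, y) \<in> G \<Longrightarrow> (c *\<^sub>C x, c *\<^sub>C y) \<in> G"
    and bd: "\<And>x y. (x, y) \<in> G \<Longrightarrow> norm y \<le> norm x"
  shows "\<exists>T. clin T \<and> (\<forall>(x, y)\<in>G. T x = y)"
proof -
  let ?Z = "orth (fst ` G)"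
  define G' where "G' = {(x + z, y) |x y z. (x, y) \<in> G \<and> z \<in> ?Z}"
  have Z: "subspace ?Z" "hilbert ?Z" by (simp_all add: hilbert_orth hilbert_subspace)
  have G'I: "(x + z, y) \<in> G'" if "(x, y) \<in> G" "z \<in> ?Z" for x y z using that by (auto simp: G'_def)
  have G'E: "\<exists>x z. u = x + z \<and> (x, y) \<in> G \<and> z \<in> ?Z" if "(u, y) \<in> G'" for u y
    using that by (auto simp: G'_def)
  have 00: "(0, 0) \<in> G" using subspace_0[OF G(1)] by (simp add: zero_prod_def)
  have scale: "(c *\<^sub>C u, c *\<^sub>C y) \<in> G'" if "(u, y) \<in> G'" for c u y
    using G'E[OF that] G(2) Z(2) G'I by (metis hilbert_def scaleC_add_right)
  have add: "(u + u', y + y') \<in> G'" if u: "(u, y) \<in> G'" "(u', y') \<in> G'" for u u' y y'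
  proof -
    obtain x z where xz: "u = x + z" "(x, y) \<in> G" "z \<in> ?Z" using G'E[OF u(1)] by blast
    obtain x' z' where xz': "u' = x' + z'" "(x', y') \<in> G" "z' \<in> ?Z" using G'E[OF u(2)] by blast
    have "((x + x') + (z + z'), y + y') \<in> G'"
      using subspace_add[OF G(1) xz(2) xz'(2)] subspace_add[OF Z(1) xz(3) xz'(3)]
      by (intro G'I) simp_all
    then show ?thesis by (simp add: xz(1) xz'(1) algebra_simps)
  qed
  have zero: "(0, 0) \<in> G'" using G'I[OF 00 subspace_0[OF Z(1)]] by simp
  have sub: "subspace G'"
    unfolding subspace_def using zero add scale by (auto simp: zero_prod_def scaleR_scaleC)
  have dense: "closure (fst ` G') = UNIV"
  proof (rule closure_eq_UNIV[OF fst_image_subspace[OF sub scale]])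
    fix x assume x: "x \<in> orth (fst ` G')"
    have "x \<in> ?Z"
    proof (rule orthI)
      fix m assume "m \<in> fst ` G"
      then obtain y where "(m, y) \<in> G" by force
      then have "(m, y) \<in> G'" using G'I[of m y 0] subspace_0[OF Z(1)] by simp
      then have "m \<in> fst ` G'" by force
      then show "cinner x m = 0" by (rule orthD[OF x])
    qed
    then have "(x, 0) \<in> G'" using G'I[OF 00] by force
    then have "x \<in> fst ` G'" by force
    then show "x = 0" using orthD[OF x, of x] by simp
  qed
  have bd': "norm y \<le> 1 * norm u" if u: "(u, y) \<in> G'" for u y
  proof -
    obtain x z where xz: "u = x + z" "(x, y) \<in> G" "z \<in> ?Z" using G'E[OF u] by blast
    have "cinner x z = 0" using orthD'[OF xz(3) imageI[OF xz(2), of fst]] by simp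
    from norm_add_orthogonal[OF this] have "(norm x)\<^sup>2 \<le> (norm u)\<^sup>2" by (simp add: xz(1))
    then have "norm x \<le> norm u" using norm_ge_zero by (rule power2_le_imp_le)
    with bd[OF xz(2)] show ?thesis by linarith
  qed
  have "\<exists>T. clin T \<and> (\<forall>(x, y)\<in>G'. T x = y)"
    by (rule dense_graph_extension[OF sub scale bd' dense])
  then obtain T where T: "clin T" "\<forall>(x, y)\<in>G'. T x = y" by blast
  have "T x = y" if "(x, y) \<in> G" for x y
    using bspec[OF T(2) G'I[OF that subspace_0[OF Z(1)]]] by simp
  then show ?thesis using T(1) by blast
qed

text \<open>Equal Gram matrices make the span of the pairs an isometric graph. The last conclusion
  says that \<open>T\<close> is isometric on the closed span of the \<open>x i\<close>; membership
  in that span is expressed by double orthogonality, which is easy to check in the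
  applications.\<close>

lemma gram_extension:
  fixes x :: "'i \<Rightarrow> 'a::chilbert_space" and y :: "'i \<Rightarrow> 'b::chilbert_space"
  assumes gram: "\<And>i j. i \<in> I \<Longrightarrow> j \<in> I \<Longrightarrow> cinner (x i) (x j) = cinner (y i) (y j)"
  obtains T where "clin T" "\<And>i. i \<in> I \<Longrightarrow> T (x i) = y i"
    "\<And>v. (\<And>u. (\<And>i. i \<in> I \<Longrightarrow> cinner u (x i) = 0) \<Longrightarrow> cinner v u = 0) \<Longrightarrow> norm (T v) = norm v"
proof -
  define S where "S = {(c *\<^sub>C x i, c *\<^sub>C y i) |c i. i \<in> I}"
  define G where "G = span S"
  have G: "subspace G" by (simp add: G_def)
  have inS: "inner (fst p) (fst q) = inner (snd p) (snd q)" if "p \<in> S" "q \<in> S" for p q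
    using that gram by (auto simp: S_def inner_cinner cinner_scaleC_left cinner_scaleC_right)
  have inS': "inner (fst p) (fst q) = inner (snd p) (snd q)" if "p \<in> S" "q \<in> G" for p q
    using that(2) unfolding G_def
  proof (induction rule: span_induct)
    case base
    show ?case by (auto simp: subspace_def inner_add_right)
  qed (use that(1) inS in blast)
  have inG: "inner (fst p) (fst q) = inner (snd p) (snd q)" if "p \<in> G" "q \<in> G" for p q
    using that(1) unfolding G_def
  proof (induction rule: span_induct)
    case base
    show ?case by (auto simp: subspace_def inner_add_left)
  qed (use that(2) inS' in blast)
  have norm_eq: "norm v = norm u" if "(u, v) \<in> G" for u v
    using inG[OF that that] by (simp add: norm_eq)
  have scale: "(c *\<^sub>C u, c *\<^sub>C v) \<in> G" if "(u, v) \<in> G" for c u v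
    using that unfolding G_def
  proof (rule span_pair_scaleC[rotated])
    fix u v assume "(u, v) \<in> S"
    then obtain d i where "i \<in> I" "(u, v) = (d *\<^sub>C x i, d *\<^sub>C y i)" by (auto simp: S_def)
    then have "(c *\<^sub>C u, c *\<^sub>C v) = ((c * d) *\<^sub>C x i, (c * d) *\<^sub>C y i)"
      by (simp add: scaleC_scaleC)
    then show "(c *\<^sub>C u, c *\<^sub>C v) \<in> S" using \<open>i \<in> I\<close> unfolding S_def by blast
  qed
  have "\<exists>T. clin T \<and> (\<forall>(u, v)\<in>G. T u = v)"
  proof (rule graph_extension[OF G])
    show "(c *\<^sub>C u, c *\<^sub>C v) \<in> G" if "(u, v) \<in> G" for c u v using that by (rule scale)
    show "norm v \<le> norm u" if "(u, v) \<in> G" for u v using norm_eq[OF that] by simp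
  qed
  then obtain T where T: "clin T" "\<forall>(u, v)\<in>G. T u = v" by blast
  have xy: "(x i, y i) \<in> G" if "i \<in> I" for i
  proof -
    have "(1 *\<^sub>C x i, 1 *\<^sub>C y i) \<in> S" unfolding S_def using that by blast
    then show ?thesis by (simp add: G_def span_base)
  qed
  have hil: "hilbert (closure (fst ` G))"
    by (rule hilbert_closure[OF fst_image_subspace[OF G scale]])
  have "closure (fst ` G) \<subseteq> {v. norm (T v) = norm v}"
  proof (rule closure_minimal)
    show "fst ` G \<subseteq> {v. norm (T v) = norm v}" using T(2) norm_eq by auto
    show "closed {v. norm (T v) = norm v}"
      by (intro closed_Collect_eq continuous_intros clin_continuous_on[OF T(1)])
  qed
  moreover have "v \<in> closure (fst ` G)"
    if v: "\<And>u. (\<And>i. i \<in> I \<Longrightarrow> cinner u (x i) = 0) \<Longrightarrow> cinner v u = 0" for v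
  proof -
    obtain p q where pq: "p \<in> closure (fst ` G)" "q \<in> orth (closure (fst ` G))" "v = p + q"
      using orth_decompose[OF hil] by blast
    have "cinner q (x i) = 0" if "i \<in> I" for i
      using orthD[OF pq(2), of "x i"] xy[OF that] closure_subset[of "fst ` G"] by force
    then have "cinner v q = 0" by (rule v)
    moreover have "cinner p q = 0" using orthD'[OF pq(2,1)] .
    ultimately have "q = 0" using cinner_add_left[of p q q] by (simp add: pq(3))
    then show ?thesis using pq by simp
  qed
  moreover have "T (x i) = y i" if "i \<in> I" for i using bspec[OF T(2) xy[OF that]] by simp
  ultimately show thesis using T(1) that by blast
qed

section \<open>Positive square roots\<close>

definition selfadjoint :: "('a::chilbert_space \<Rightarrow> 'a) \<Rightarrow> bool" where
  "selfadjoint A \<longleftrightarrow> clin A \<and> (\<forall>x y. cinner (A x) y = cinner x (A y))"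

definition pos_op :: "('a::chilbert_space \<Rightarrow> 'a) \<Rightarrow> bool" where
  "pos_op A \<longleftrightarrow> selfadjoint A \<and> (\<forall>x. 0 \<le> inner (A x) x)"

lemma selfadjoint_clin: "selfadjoint A \<Longrightarrow> clin A"
  by (simp add: selfadjoint_def)

lemma selfadjoint_cinner: "selfadjoint A \<Longrightarrow> cinner (A x) y = cinner x (A y)"
  by (simp add: selfadjoint_def)

lemma selfadjoint_inner: "selfadjoint A \<Longrightarrow> inner (A x) y = inner x (A y)"
  by (simp add: inner_cinner selfadjoint_cinner)

lemma pos_op_selfadjoint: "pos_op A \<Longrightarrow> selfadjoint A"
  by (simp add: pos_op_def)

lemma pos_op_clin: "pos_op A \<Longrightarrow> clin A"
  by (simp add: pos_op_def selfadjoint_def)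

lemma selfadjoint_square_pos: assumes "selfadjoint A" shows "pos_op (\<lambda>x. A (A x))"
proof -
  have "cinner (A (A x)) x = cinner (A x) (A x)" for x by (simp add: selfadjoint_cinner[OF assms])
  then have "0 \<le> inner (A (A x)) x" for x by (simp add: inner_cinner cinner_self)
  then show ?thesis using assms clin_compose[of A A] by (simp add: pos_op_def selfadjoint_def)
qed

text \<open>A real quadratic form is symmetric: its values at \<open>x + y\<close> settle the
  imaginary parts, those at \<open>x + \<i> *\<^sub>C y\<close> the real parts.\<close>

lemma pos_op_iff_positive_op: "positive_op UNIV A \<longleftrightarrow> pos_op A"
proof
  assume A: "positive_op UNIV A"
  then have c: "clin A" and im: "Im (cinner (A x) x) = 0" and re: "0 \<le> Re (cinner (A x) x)" for x
    by (auto simp: positive_op_def bounded_ops_UNIV complex_is_Real_iff)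
  have im_sum: "Im (cinner (A x) y) + Im (cinner (A y) x) = 0" for x y
    using im[of "x + y"] im[of x] im[of y]
    by (simp add: clin_add[OF c] cinner_add_left cinner_add_right)
  have "cinner (A x) y = cinner x (A y)" for x y
  proof -
    have "Im (cinner (A x) y) = - Im (cinner (A y) x)" using im_sum[of x y] by simp
    moreover have "Re (cinner (A x) y) = Re (cinner (A y) x)"
      using im_sum[of x "\<i> *\<^sub>C y"]
      by (simp add: clin_scaleC[OF c] cinner_scaleC_left cinner_scaleC_right)
    ultimately show ?thesis
      by (subst cinner_commute[of x]) (simp add: complex_eq_iff)
  qed
  then show "pos_op A" using c re by (simp add: pos_op_def selfadjoint_def inner_cinner)
next
  assume A: "pos_op A"
  then have "cinner (A x) x = cnj (cinner (A x) x)" for x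
    by (metis cinner_commute pos_op_def selfadjoint_def)
  then have "cinner (A x) x \<in> \<real>" for x by (metis Reals_cnj_iff)
  then show "positive_op UNIV A"
    using A by (simp add: positive_op_def pos_op_def selfadjoint_clin bounded_ops_UNIV inner_cinner)
qed

text \<open>Positivity is tested at \<open>x - (1/M) *\<^sub>R A x\<close>; the bound on
  \<open>A\<close> controls the quadratic term. It yields both the contractivity needed for the
  square root and the fact that a vanishing form forces \<open>A x = 0\<close>.\<close>

lemma pos_op_norm_bound:
  assumes A: "pos_op A" and M: "M > 0" "\<And>x. norm (A x) \<le> M * norm x"
  shows "(norm (A x))\<^sup>2 \<le> M * inner (A x) x"
proof -
  note c = pos_op_clin[OF A] and sa = pos_op_selfadjoint[OF A]
  define t where "t = 1 / M"
  let ?y = "A x"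
  have "0 \<le> inner (A (x - t *\<^sub>R ?y)) (x - t *\<^sub>R ?y)" using A by (simp add: pos_op_def)
  also have "\<dots> = inner ?y x - 2 * t * (norm ?y)\<^sup>2 + t * (t * inner (A ?y) ?y)"
    using selfadjoint_inner[OF sa, of ?y x]
    by (simp add: clin_diff[OF c] linear_scale[OF clin_linear[OF c]] inner_diff_left inner_diff_right
        power2_norm_eq_inner algebra_simps)
  finally have *: "0 \<le> inner ?y x - 2 * t * (norm ?y)\<^sup>2 + t * (t * inner (A ?y) ?y)" .
  have "inner (A ?y) ?y \<le> norm (A ?y) * norm ?y" by (rule norm_cauchy_schwarz)
  also have "\<dots> \<le> M * norm ?y * norm ?y" by (intro mult_right_mono M) simp
  finally have "t * inner (A ?y) ?y \<le> t * (M * (norm ?y)\<^sup>2)"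
    using M(1) by (intro mult_left_mono) (auto simp: t_def power2_eq_square)
  also have "\<dots> = (norm ?y)\<^sup>2" using M(1) by (simp add: t_def)
  finally have "t * (t * inner (A ?y) ?y) \<le> t * (norm ?y)\<^sup>2"
    using M(1) by (intro mult_left_mono) (auto simp: t_def)
  with * have "t * (norm ?y)\<^sup>2 \<le> inner ?y x" by simp
  then show ?thesis using M(1) by (simp add: t_def field_simps)
qed

text \<open>The iteration \<open>Y \<mapsto> (D + Y\<^sup>2)/2\<close> is dominated by its scalar counterpart with \<open>D = 1\<close>,
  whose iterates increase and stay below \<open>1\<close>; its limit \<open>Z\<close> satisfies \<open>(I - Z)\<^sup>2 = I - D\<close>.\<close>

fun root_iter :: "('a::chilbert_space \<Rightarrow> 'a) \<Rightarrow> nat \<Rightarrow> 'a \<Rightarrow> 'a" where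
  "root_iter D 0 = (\<lambda>x. 0)"
| "root_iter D (Suc n) = (\<lambda>x. (1/2) *\<^sub>R (D x + root_iter D n (root_iter D n x)))"

fun root_bound :: "nat \<Rightarrow> real" where
  "root_bound 0 = 0"
| "root_bound (Suc n) = (1 + (root_bound n)\<^sup>2) / 2"

lemma root_bound_le: "0 \<le> root_bound n \<and> root_bound n \<le> 1"
  by (induction n) (auto simp: power_le_one)

lemma root_bound_mono: "root_bound n \<le> root_bound (Suc n)"
proof -
  have "0 \<le> (1 - root_bound n)\<^sup>2" by simp
  then show ?thesis by (simp add: power2_diff)
qed

lemma clin_zero_op: "clin (\<lambda>x. 0)"
  by (simp add: clin_def bounded_linear_zero)

lemma clin_plus: "clin A \<Longrightarrow> clin B \<Longrightarrow> clin (\<lambda>x. A x + B x)"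
  by (simp add: clin_def bounded_linear_add scaleC_add_right)

lemma clin_scaleR: "clin A \<Longrightarrow> clin (\<lambda>x. r *\<^sub>R A x)"
  using bounded_linear_compose[OF bounded_linear_scaleR_right, of A r]
  by (simp add: clin_def scaleR_scaleC scaleC_scaleC mult.commute)

lemma clin_minus: "clin A \<Longrightarrow> clin B \<Longrightarrow> clin (\<lambda>x. A x - B x)"
  using clin_plus[of A "\<lambda>x. (-1) *\<^sub>R B x"] clin_scaleR[of B "-1"] by simp

lemma clin_real_scale: "clin A \<Longrightarrow> A (r *\<^sub>R x) = r *\<^sub>R A x"
  by (simp add: clin_linear linear_scale)

lemma cinner_scaleR_left: "cinner (r *\<^sub>R x) y = of_real r * cinner x y"
  by (simp add: scaleR_scaleC cinner_scaleC_left)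

lemma cinner_scaleR_right: "cinner x (r *\<^sub>R y) = of_real r * cinner x y"
  by (simp add: scaleR_scaleC cinner_scaleC_right)

lemma root_iter_selfadjoint:
  assumes "selfadjoint D" shows "selfadjoint (root_iter D n)"
proof (induction n)
  case 0
  show ?case by (simp add: selfadjoint_def clin_zero_op)
next
  case (Suc n)
  then show ?case using assms
    by (simp add: selfadjoint_def clin_scaleR clin_plus clin_compose cinner_scaleR_left
        cinner_scaleR_right cinner_add_left cinner_add_right)
qed

text \<open>Every iterate is a polynomial in \<open>D\<close>; in particular the iterates commute
  with each other.\<close>

lemma root_iter_commute:
  assumes T: "clin T" "\<And>x. T (D x) = D (T x)"
  shows "T (root_iter D n x) = root_iter D n (T x)"
proof (induction n arbitrary: x)
  case 0
  show ?case by (simp add: clin_zero[OF T(1)])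
next
  case (Suc n)
  then show ?case by (simp add: clin_add[OF T(1)] clin_real_scale[OF T(1)] T(2))
qed

lemma root_iter_norm:
  assumes D: "\<And>x. norm (D x) \<le> norm x"
  shows "norm (root_iter D n x) \<le> root_bound n * norm x"
proof (induction n arbitrary: x)
  case (Suc n)
  have "norm (root_iter D n (root_iter D n x)) \<le> root_bound n * norm (root_iter D n x)" by (rule Suc)
  also have "\<dots> \<le> root_bound n * (root_bound n * norm x)"
    using root_bound_le by (intro mult_left_mono Suc) auto
  finally have "norm (root_iter D n (root_iter D n x)) \<le> (root_bound n)\<^sup>2 * norm x"
    by (simp add: power2_eq_square mult.assoc)
  moreover have "norm (D x + root_iter D n (root_iter D n x)) \<le> norm (D x) + norm (root_iter D n (root_iter D n x))"
    by (rule norm_triangle_ineq)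
  ultimately have "norm (D x + root_iter D n (root_iter D n x)) \<le> (1 + (root_bound n)\<^sup>2) * norm x"
    using D[of x] unfolding distrib_right by linarith
  then show ?case by simp
qed simp

text \<open>Commuting iterates satisfy \<open>Y'\<^sup>2 - Y\<^sup>2 = (Y' + Y) (Y' - Y)\<close>.
  The scalar sequence obeys the same identity, so the scalar increments dominate by
  induction.\<close>

lemma root_iter_step:
  assumes D: "selfadjoint D" "\<And>x. norm (D x) \<le> norm x"
  shows "norm (root_iter D (Suc n) x - root_iter D n x) \<le> (root_bound (Suc n) - root_bound n) * norm x"
proof (induction n arbitrary: x)
  case 0
  show ?case using D(2)[of x] by simp
next
  case (Suc n)
  let ?Y = "root_iter D n" and ?Y' = "root_iter D (Suc n)"
  have cD: "clin D" using D(1) by (rule selfadjoint_clin)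
  have cY: "clin ?Y" "clin ?Y'" using root_iter_selfadjoint[OF D(1)] selfadjoint_clin by blast+
  have YD: "?Y (D x) = D (?Y x)" for x by (rule root_iter_commute[where D = D, OF cD refl, symmetric])
  have comm: "?Y (?Y' x) = ?Y' (?Y x)" for x by (rule root_iter_commute[where D = D, OF cY(1) YD])
  define z where "z = ?Y' x - ?Y x"
  have step: "root_iter D (Suc k) x = (1/2) *\<^sub>R (D x + root_iter D k (root_iter D k x))" for k
    by simp
  have "root_iter D (Suc (Suc n)) x - ?Y' x
      = (1/2) *\<^sub>R (D x + ?Y' (?Y' x)) - (1/2) *\<^sub>R (D x + ?Y (?Y x))"
    by (rule arg_cong2[where f = "(-)", OF step step])
  also have "\<dots> = (1/2) *\<^sub>R (?Y' (?Y' x) - ?Y (?Y x))" by (simp add: algebra_simps del: root_iter.simps)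
  also have "?Y' (?Y' x) - ?Y (?Y x) = ?Y' z + ?Y z"
    by (simp add: z_def clin_diff[OF cY(1)] clin_diff[OF cY(2)] comm del: root_iter.simps)
  finally have eq: "root_iter D (Suc (Suc n)) x - ?Y' x = (1/2) *\<^sub>R (?Y' z + ?Y z)" .
  have "norm (?Y' z + ?Y z) \<le> root_bound (Suc n) * norm z + root_bound n * norm z"
    by (rule order_trans[OF norm_triangle_ineq add_mono[OF root_iter_norm root_iter_norm]]) (rule D(2))+
  also have "\<dots> = (root_bound (Suc n) + root_bound n) * norm z" by (simp only: distrib_right)
  also have "\<dots> \<le> (root_bound (Suc n) + root_bound n) * ((root_bound (Suc n) - root_bound n) * norm x)"
    unfolding z_def using root_bound_le[of n] root_bound_le[of "Suc n"]
    by (intro mult_left_mono Suc.IH) linarith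
  finally have "norm (?Y' z + ?Y z) / 2
      \<le> ((root_bound (Suc n) + root_bound n) * ((root_bound (Suc n) - root_bound n) * norm x)) / 2"
    by (rule divide_right_mono) simp
  also have "\<dots> = ((root_bound (Suc n) + root_bound n) * (root_bound (Suc n) - root_bound n)) / 2 * norm x"
    by (simp only: mult.assoc times_divide_eq_left)
  also have "((root_bound (Suc n) + root_bound n) * (root_bound (Suc n) - root_bound n)) / 2
      = root_bound (Suc (Suc n)) - root_bound (Suc n)"
    using arg_cong2[where f = "(-)", OF root_bound.simps(2)[of "Suc n"] root_bound.simps(2)[of n]]
    by (simp add: power2_eq_square algebra_simps diff_divide_distrib add_divide_distrib del: root_bound.simps)
  finally show ?case unfolding eq by (simp del: root_bound.simps root_iter.simps)
qed

lemma contraction_root: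
  assumes D: "selfadjoint D" "\<And>x. norm (D x) \<le> norm x"
  obtains Z where "selfadjoint Z" "\<And>x. norm (Z x) \<le> norm x"
    "\<And>x. Z (Z x) = 2 *\<^sub>R Z x - D x"
    "\<And>T x. clin T \<Longrightarrow> (\<And>x. T (D x) = D (T x)) \<Longrightarrow> T (Z x) = Z (T x)"
proof -
  let ?Y = "root_iter D" and ?r = root_bound
  have diff: "norm (?Y (n + k) x - ?Y n x) \<le> (?r (n + k) - ?r n) * norm x" for n k x
  proof (induction k)
    case (Suc k)
    have "norm (?Y (n + Suc k) x - ?Y n x)
        \<le> norm (?Y (Suc (n + k)) x - ?Y (n + k) x) + norm (?Y (n + k) x - ?Y n x)"
      by (rule order_trans[OF _ norm_triangle_ineq]) (simp del: root_iter.simps)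
    also have "\<dots> \<le> (?r (Suc (n + k)) - ?r (n + k)) * norm x + (?r (n + k) - ?r n) * norm x"
      by (intro add_mono root_iter_step D Suc)
    also have "\<dots> = (?r (n + Suc k) - ?r n) * norm x" by (simp add: algebra_simps del: root_bound.simps)
    finally show ?case .
  qed simp
  have inc: "incseq ?r" using root_bound_mono by (rule incseq_SucI)
  have "convergent ?r"
    using inc root_bound_le by (meson incseq_convergent convergentI)
  then have Cr: "Cauchy ?r" by (rule convergent_Cauchy)
  have "convergent (\<lambda>n. ?Y n x)" for x
  proof (rule Cauchy_convergent, rule metric_CauchyI)
    fix e :: real assume "e > 0"
    then have "e / (norm x + 1) > 0" by (simp add: add_nonneg_pos)
    then obtain N where N: "\<And>m n. m \<ge> N \<Longrightarrow> n \<ge> N \<Longrightarrow> dist (?r m) (?r n) < e / (norm x + 1)"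
      using Cr unfolding Cauchy_def by metis
    have *: "dist (?Y m x) (?Y n x) < e" if "m \<ge> n" "n \<ge> N" for m n
    proof -
      have "norm (?Y m x - ?Y n x) \<le> (?r m - ?r n) * norm x" using diff[of n "m - n" x] that by simp
      also have "\<dots> \<le> (?r m - ?r n) * (norm x + 1)"
        using incseqD[OF inc that(1)] by (intro mult_left_mono) auto
      also have "\<dots> < e"
        using N[of m n] that incseqD[OF inc that(1)]
        by (simp add: dist_real_def pos_less_divide_eq add_nonneg_pos)
      finally show ?thesis by (simp add: dist_norm)
    qed
    have "dist (?Y m x) (?Y n x) < e" if "m \<ge> N" "n \<ge> N" for m n
      using *[of n m] *[of m n] that by (cases "m \<ge> n") (auto simp: dist_commute)
    then show "\<exists>N. \<forall>m\<ge>N. \<forall>n\<ge>N. dist (?Y m x) (?Y n x) < e" by blast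
  qed
  then obtain Z where Z: "\<And>x. (\<lambda>n. ?Y n x) \<longlonglongrightarrow> Z x" unfolding convergent_def by metis
  have saY: "selfadjoint (?Y n)" for n by (rule root_iter_selfadjoint[OF D(1)])
  note cY = selfadjoint_clin[OF saY]
  have nY: "norm (?Y n x) \<le> norm x" for n x
  proof -
    have "?r n * norm x \<le> 1 * norm x" using root_bound_le by (intro mult_right_mono) auto
    then show ?thesis using root_iter_norm[OF D(2), of n x] by simp
  qed
  have nZ: "norm (Z x) \<le> norm x" for x
    using tendsto_norm[OF Z] by (rule LIMSEQ_le_const2) (use nY in blast)
  have cZ: "clin Z"
    unfolding bounded_ops_UNIV[symmetric] bounded_ops_def
  proof (intro CollectI conjI ballI allI)
    show "Z (x + y) = Z x + Z y" for x y
      using LIMSEQ_unique[OF Z[of "x + y"]] tendsto_add[OF Z[of x] Z[of y]]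
      by (simp add: clin_add[OF cY])
    show "Z (c *\<^sub>C x) = c *\<^sub>C Z x" for c x
      using LIMSEQ_unique[OF Z[of "c *\<^sub>C x"]] bounded_linear.tendsto[OF bounded_linear_scaleC Z[of x]]
      by (simp add: clin_scaleC[OF cY])
    show "\<exists>M. \<forall>x\<in>UNIV. norm (Z x) \<le> M * norm x" using nZ by (intro exI[of _ 1]) simp
  qed simp
  have tl: "(\<lambda>n. cinner (?Y n x) y) \<longlonglongrightarrow> cinner (Z x) y" for x y
    unfolding cinner_eq_inner Complex_eq by (intro tendsto_intros Z)
  have tr: "(\<lambda>n. cinner y (?Y n x)) \<longlonglongrightarrow> cinner y (Z x)" for x y
    unfolding cinner_eq_inner Complex_eq
    by (intro tendsto_intros Z bounded_linear.tendsto[OF bounded_linear_scaleC])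
  have "cinner (Z x) y = cinner x (Z y)" for x y
    using LIMSEQ_unique[OF tl[of x y]] tr[of x y] by (simp add: selfadjoint_cinner[OF saY])
  with cZ have saZ: "selfadjoint Z" by (simp add: selfadjoint_def)
  \<comment> \<open>Pointwise convergence passes to squares because the iterates are uniformly
    contractive.\<close>
  have sq: "(\<lambda>n. ?Y n (?Y n x)) \<longlonglongrightarrow> Z (Z x)" for x
  proof -
    have "(\<lambda>n. norm (?Y n x - Z x) + norm (?Y n (Z x) - Z (Z x))) \<longlonglongrightarrow> norm (Z x - Z x) + norm (Z (Z x) - Z (Z x))"
      by (intro tendsto_intros Z)
    then have lim: "(\<lambda>n. norm (?Y n x - Z x) + norm (?Y n (Z x) - Z (Z x))) \<longlonglongrightarrow> 0" by simp
    have "norm (?Y n (?Y n x) - Z (Z x)) \<le> norm (?Y n x - Z x) + norm (?Y n (Z x) - Z (Z x))" for n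
    proof -
      have "?Y n (?Y n x) - Z (Z x) = ?Y n (?Y n x - Z x) + (?Y n (Z x) - Z (Z x))"
        by (simp add: clin_diff[OF cY])
      then show ?thesis using norm_triangle_ineq[of "?Y n (?Y n x - Z x)"] nY[of n "?Y n x - Z x"]
        by (simp only:) (smt (verit))
    qed
    then have "(\<lambda>n. ?Y n (?Y n x) - Z (Z x)) \<longlonglongrightarrow> 0"
      by (intro tendsto_0_le[OF lim, of _ 1] always_eventually allI) simp
    then show ?thesis by (simp add: LIM_zero_iff)
  qed
  have ZZ: "Z (Z x) = 2 *\<^sub>R Z x - D x" for x
  proof -
    have "(\<lambda>n. ?Y (Suc n) x) \<longlonglongrightarrow> (1/2) *\<^sub>R (D x + Z (Z x))"
      unfolding root_iter.simps by (intro tendsto_intros sq)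
    moreover have "(\<lambda>n. ?Y (Suc n) x) \<longlonglongrightarrow> Z x" using Z by (rule LIMSEQ_Suc)
    ultimately have "Z x = (1/2) *\<^sub>R (D x + Z (Z x))" using LIMSEQ_unique by blast
    then have "2 *\<^sub>R Z x = 2 *\<^sub>R ((1/2) *\<^sub>R (D x + Z (Z x)))" by (rule arg_cong)
    then show ?thesis by simp
  qed
  have "T (Z x) = Z (T x)" if T: "clin T" "\<And>x. T (D x) = D (T x)" for T x
    using LIMSEQ_unique[OF bounded_linear.tendsto[OF clin_bounded_linear[OF T(1)] Z[of x]]] Z[of "T x"]
    by (simp add: root_iter_commute[where D = D, OF T])
  with saZ nZ ZZ show thesis by (rule that)
qed

lemma pos_sqrt:
  assumes A: "pos_op A"
  obtains B where "pos_op B" "\<And>x. B (B x) = A x"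
    "\<And>T x. clin T \<Longrightarrow> (\<And>x. T (A x) = A (T x)) \<Longrightarrow> T (B x) = B (T x)"
proof -
  note c = pos_op_clin[OF A] and sa = pos_op_selfadjoint[OF A]
  obtain M where M: "M > 0" "\<And>x. norm (A x) \<le> M * norm x" using clin_bound[OF c] by blast
  \<comment> \<open>Dividing by the bound \<open>M\<close> makes \<open>I - A/M\<close> a
    contraction.\<close>
  define D where "D x = x - (1/M) *\<^sub>R A x" for x
  have "selfadjoint D"
    unfolding selfadjoint_def D_def using sa c
    by (simp add: clin_minus clin_ident clin_scaleR cinner_diff_left cinner_diff_right
        cinner_scaleR_left cinner_scaleR_right selfadjoint_cinner)
  moreover have "norm (D x) \<le> norm x" for x
  proof -
    have "(norm (D x))\<^sup>2 = (norm x)\<^sup>2 - 2 * (inner (A x) x / M) + (norm (A x))\<^sup>2 / M\<^sup>2"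
      unfolding D_def power2_norm_eq_inner
      by (simp add: inner_diff_left inner_diff_right inner_commute power2_eq_square algebra_simps)
    also have "(norm (A x))\<^sup>2 / M\<^sup>2 \<le> inner (A x) x / M"
      using pos_op_norm_bound[OF A M, of x] M(1) by (simp add: field_simps power2_eq_square)
    finally have "(norm (D x))\<^sup>2 \<le> (norm x)\<^sup>2 - inner (A x) x / M" by simp
    also have "\<dots> \<le> (norm x)\<^sup>2" using A M(1) by (simp add: pos_op_def)
    finally show ?thesis using norm_ge_zero by (rule power2_le_imp_le)
  qed
  ultimately obtain Z where Z: "selfadjoint Z" "\<And>x. norm (Z x) \<le> norm x"
    "\<And>x. Z (Z x) = 2 *\<^sub>R Z x - D x"
    "\<And>T x. clin T \<Longrightarrow> (\<And>x. T (D x) = D (T x)) \<Longrightarrow> T (Z x) = Z (T x)"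
    using contraction_root by blast
  have cZ: "clin Z" using Z(1) by (rule selfadjoint_clin)
  \<comment> \<open>The equation for \<open>Z\<close> says
    \<open>(I - Z)\<^sup>2 = I - D = A/M\<close>; contractivity of \<open>Z\<close> makes
    \<open>I - Z\<close> positive.\<close>
  define B where "B x = sqrt M *\<^sub>R (x - Z x)" for x
  show thesis
  proof (rule that[of B])
    have "0 \<le> inner (x - Z x) x" for x
    proof -
      have "inner (Z x) x \<le> norm (Z x) * norm x" by (rule norm_cauchy_schwarz)
      also have "\<dots> \<le> norm x * norm x" by (intro mult_right_mono Z) simp
      finally show ?thesis by (simp add: inner_diff_left dot_square_norm power2_eq_square)
    qed
    then show "pos_op B"
      unfolding pos_op_def selfadjoint_def B_def using Z(1) cZ M(1)
      by (simp add: clin_minus clin_ident clin_scaleR cinner_diff_left cinner_diff_right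
        cinner_scaleR_left cinner_scaleR_right selfadjoint_cinner)
    show "B (B x) = A x" for x
    proof -
      have "B (B x) = (sqrt M * sqrt M) *\<^sub>R ((x - Z x) - (Z x - Z (Z x)))"
        by (simp add: B_def clin_real_scale[OF cZ] clin_diff[OF cZ] algebra_simps)
      also have "\<dots> = M *\<^sub>R ((1/M) *\<^sub>R A x)" using M(1)
        by (simp add: Z(3) D_def scaleR_2 algebra_simps)
      finally show ?thesis using M(1) by simp
    qed
    show "T (B x) = B (T x)" if T: "clin T" "\<And>x. T (A x) = A (T x)" for T x
    proof -
      have "T (D x) = D (T x)" for x by (simp add: D_def clin_diff[OF T(1)] clin_real_scale[OF T(1)] T(2))
      then have "T (Z x) = Z (T x)" by (rule Z(4)[OF T(1)])
      then show ?thesis by (simp add: B_def clin_diff[OF T(1)] clin_real_scale[OF T(1)])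
    qed
  qed
qed

lemma pos_op_eq_zero:
  assumes A: "pos_op A" "inner (A x) x = 0" shows "A x = 0"
proof -
  obtain M where "M > 0" "\<And>x. norm (A x) \<le> M * norm x"
    using clin_bound[OF pos_op_clin[OF A(1)]] by blast
  from pos_op_norm_bound[OF A(1) this, of x] show ?thesis using A(2) by simp
qed

text \<open>Both roots are compared with the constructed root \<open>R\<close>, which is known to
  commute with whatever commutes with the square. For \<open>y = B x - R x\<close> this gives
  \<open>B y + R y = 0\<close>; both terms have nonnegative forms, hence
  \<open>B y = R y = 0\<close> and \<open>y = 0\<close>.\<close>

lemma pos_sqrt_unique:
  assumes B: "pos_op B" and C: "pos_op C" and eq: "\<And>x. B (B x) = C (C x)"
  shows "B = C"
proof -
  have "pos_op (\<lambda>x. C (C x))" by (rule selfadjoint_square_pos[OF pos_op_selfadjoint[OF C]])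
  then obtain R where R: "pos_op R" "\<And>x. R (R x) = C (C x)"
    "\<And>T x. clin T \<Longrightarrow> (\<And>x. T (C (C x)) = C (C (T x))) \<Longrightarrow> T (R x) = R (T x)"
    using pos_sqrt by blast
  have unique: "B = R" if B: "pos_op B" "\<And>x. B (B x) = C (C x)" for B
  proof
    fix x
    note cB = pos_op_clin[OF B(1)] and cR = pos_op_clin[OF R(1)]
    have comm: "B (R y) = R (B y)" for y
      by (rule R(3)[OF cB]) (simp only: B(2)[symmetric])
    define y where "y = B x - R x"
    have "B y + R y = 0" by (simp add: y_def clin_diff[OF cB] clin_diff[OF cR] comm B(2) R(2))
    then have "inner (B y) y + inner (R y) y = 0" by (metis inner_add_left inner_zero_left)
    moreover have "0 \<le> inner (B y) y" "0 \<le> inner (R y) y" using B(1) R(1) by (auto simp: pos_op_def)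
    ultimately have "B y = 0" "R y = 0"
      using pos_op_eq_zero[OF B(1)] pos_op_eq_zero[OF R(1)] by (auto simp: add_nonneg_eq_0_iff)
    then have "inner y y = 0"
      using selfadjoint_inner[OF pos_op_selfadjoint[OF B(1)], of x y]
        selfadjoint_inner[OF pos_op_selfadjoint[OF R(1)], of x y]
      by (subst (1) y_def) (simp add: inner_diff_left)
    then show "B x = R x" by (simp add: y_def)
  qed
  show ?thesis using unique[OF B eq] unique[OF C refl] by simp
qed

lemma pos_op_dag_compose:
  assumes A: "clin A" shows "pos_op (\<lambda>x. dag A (A x))"
  using clin_compose[OF clin_dag[OF A] A]
  by (simp add: pos_op_def selfadjoint_def cinner_dag[OF A, symmetric] cinner_dag'[OF A] inner_cinner)
    (simp add: cinner_self)

lemma abs_op_eqI: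
  assumes B: "pos_op B" "\<And>x. B (B x) = dag A (A x)"
  shows "abs_op UNIV UNIV A = B"
proof -
  define P where "P = (\<lambda>C. positive_op UNIV C \<and> (\<forall>x\<in>UNIV. C (C x) = dag A (A x)))"
  have abs: "abs_op UNIV UNIV A = (SOME C. P C)" by (simp only: abs_op_def P_def)
  have "P B" using B by (simp add: P_def pos_op_iff_positive_op)
  then have "P (SOME C. P C)" by (rule someI[of P])
  then show ?thesis
    unfolding abs P_def using B by (intro pos_sqrt_unique) (simp_all add: pos_op_iff_positive_op)
qed

section \<open>Minimal normal extensions\<close>

text \<open>The difference of the adjoints maps into the complement of \<open>D\<close>, so equality
  follows without approximation by linear combinations.\<close>

lemma clin_eqI:
  assumes A: "clin A" "clin B" and eq: "\<And>d. d \<in> D \<Longrightarrow> A d = B d"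
    and total: "\<And>x. x \<in> orth D \<Longrightarrow> x = 0"
  shows "A = B"
proof
  have "dag A z - dag B z = 0" for z
  proof (rule total, rule orthI)
    fix d assume "d \<in> D"
    then show "cinner (dag A z - dag B z) d = 0"
      by (simp add: cinner_diff_left cinner_dag' A eq)
  qed
  then have eq: "dag A z = dag B z" for z by (metis right_minus_eq)
  show "A x = B x" for x
    by (rule cinner_ext) (simp add: cinner_dag A eq)
qed

text \<open>Successive ratios of a log-convex sequence increase. If the first ratio exceeded
  \<open>M\<close>, the sequence would outgrow every multiple of \<open>M ^ i\<close>.\<close>

lemma log_convex_bound:
  fixes a :: "nat \<Rightarrow> real"
  assumes nonneg: "\<And>i. 0 \<le> a i" and convex: "\<And>i. (a (Suc i))\<^sup>2 \<le> a i * a (Suc (Suc i))"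
    and growth: "\<And>i. a i \<le> K * M ^ i" and M: "M > 0"
  shows "a 1 \<le> M * a 0"
proof (rule ccontr)
  assume "\<not> a 1 \<le> M * a 0"
  then have gt: "a 1 > M * a 0" by simp
  have "a 0 \<noteq> 0"
  proof
    assume "a 0 = 0"
    then have "(a 1)\<^sup>2 \<le> 0" using convex[of 0] by simp
    then show False using gt \<open>a 0 = 0\<close> by simp
  qed
  then have a0: "a 0 > 0" using nonneg[of 0] by linarith
  define r where "r = a 1 / a 0"
  have r: "r > M" using gt a0 by (simp add: r_def pos_less_divide_eq)
  have step: "a (Suc i) \<ge> r * a i \<and> a i > 0" for i
  proof (induction i)
    case 0
    show ?case using a0 by (simp add: r_def)
  next
    case (Suc i)
    have pos: "a (Suc i) > 0" using Suc r M by (smt (verit) mult_pos_pos)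
    have "a i * (r * a (Suc i)) = (r * a i) * a (Suc i)" by simp
    also have "\<dots> \<le> a (Suc i) * a (Suc i)" using Suc pos by (intro mult_right_mono) auto
    also have "\<dots> \<le> a i * a (Suc (Suc i))" using convex[of i] by (simp add: power2_eq_square)
    finally have "r * a (Suc i) \<le> a (Suc (Suc i))" using Suc by (simp add: mult_le_cancel_left_pos)
    with pos show ?case by simp
  qed
  have low: "r ^ i * a 0 \<le> a i" for i
  proof (induction i)
    case (Suc i)
    have "r ^ Suc i * a 0 = r * (r ^ i * a 0)" by simp
    also have "\<dots> \<le> r * a i" using Suc r M by (intro mult_left_mono) auto
    finally show ?case using step[of i] by linarith
  qed simp
  have "(r / M) ^ i \<le> K / a 0" for i
  proof -
    have "r ^ i * a 0 \<le> K * M ^ i" using low[of i] growth[of i] by linarith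
    then show ?thesis using a0 M by (simp add: power_divide field_simps)
  qed
  moreover obtain n where "K / a 0 < (r / M) ^ n"
    using real_arch_pow[of "r / M" "K / a 0"] r M by auto
  ultimately show False by (meson not_le)
qed

lemma funpow_commute:
  assumes "\<And>x. f (g x) = g (f x)" shows "f ((g ^^ k) x) = (g ^^ k) (f x)"
  by (induction k) (simp_all add: assms)

lemma cinner_funpow_dag:
  fixes N :: "'a::chilbert_space \<Rightarrow> 'a"
  assumes "clin N" shows "cinner x ((dag N ^^ k) z) = cinner ((N ^^ k) x) z"
proof (induction k arbitrary: x)
  case (Suc k)
  have "cinner x ((dag N ^^ Suc k) z) = cinner (N x) ((dag N ^^ k) z)"
    by (simp add: cinner_dag[OF assms])
  then show ?case by (simp add: Suc funpow_swap1)
qed simp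

locale minimal_extension =
  fixes S :: "'b::chilbert_space \<Rightarrow> 'b" and N :: "'c::chilbert_space \<Rightarrow> 'c" and J :: "'b \<Rightarrow> 'c"
  assumes clin_S: "clin S" and minimal_extension: "minimal_normal_extension UNIV S UNIV N J"
begin

lemma clin_N: "clin N"
  and normal: "dag N (N x) = N (dag N x)"
  and clin_J: "clin J"
  and norm_J: "norm (J y) = norm y"
  and J_S: "J (S y) = N (J y)"
  and minimal: "reduces L UNIV N \<Longrightarrow> range J \<subseteq> L \<Longrightarrow> L = UNIV"
  using minimal_extension
  by (simp_all add: minimal_normal_extension_def normal_extension_def normal_op_def
      op_extension_def isometric_embedding_def bounded_ops_UNIV)

lemma cinner_J: "cinner (J x) (J y) = cinner x y"
  by (rule isometry_cinner[OF clin_J norm_J])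

lemma dag_J: "dag J (J x) = x"
  using isometry_iff_dag[OF clin_J] norm_J by blast

lemma reducing_eq_UNIV:
  assumes L: "hilbert L" "\<And>x. x \<in> L \<Longrightarrow> N x \<in> L" "\<And>x. x \<in> L \<Longrightarrow> dag N x \<in> L" "range J \<subseteq> L"
  shows "L = UNIV"
proof (rule minimal[OF _ L(4)])
  show "reduces L UNIV N"
    unfolding reduces_def Let_def using L(1-3) by (auto simp: cinner_dag[OF clin_N])
qed

text \<open>Powers of \<open>N\<close> itself are absorbed: by normality they pass to
  \<open>J y\<close>, where they act as powers of \<open>S\<close>.\<close>

definition gens :: "'c set" where
  "gens = {(dag N ^^ k) (J y) |k y. True}"

lemma gensI: "(dag N ^^ k) (J y) \<in> gens"
  by (auto simp: gens_def)

lemma N_gens: "N ((dag N ^^ k) (J y)) = (dag N ^^ k) (J (S y))"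
  by (simp add: funpow_commute[of N "dag N", OF normal[symmetric]] J_S)

text \<open>Invariance of a set under \<open>N\<close> passes to its complement as invariance under
  \<open>dag N\<close>, and conversely. Hence the double complement of \<open>gens\<close> is a
  reducing subspace containing the range of \<open>J\<close>, and minimality applies.\<close>

lemma gens_total: assumes "x \<in> orth gens" shows "x = 0"
proof -
  have dag_inv: "dag N x \<in> orth M" if "\<And>m. m \<in> M \<Longrightarrow> N m \<in> M" "x \<in> orth M" for M x
    using that by (auto simp: orth_def cinner_dag'[OF clin_N])
  have N_inv: "N x \<in> orth M" if "\<And>m. m \<in> M \<Longrightarrow> dag N m \<in> M" "x \<in> orth M" for M x
    using that by (auto simp: orth_def cinner_dag[OF clin_N])
  have "N g \<in> gens" if g: "g \<in> gens" for g
  proof -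
    obtain k y where "g = (dag N ^^ k) (J y)" using g by (auto simp: gens_def)
    then show ?thesis using gensI[of k "S y"] by (simp add: N_gens)
  qed
  moreover have "dag N g \<in> gens" if g: "g \<in> gens" for g
  proof -
    obtain k y where "g = (dag N ^^ k) (J y)" using g by (auto simp: gens_def)
    then show ?thesis using gensI[of "Suc k" y] by simp
  qed
  ultimately have "N x \<in> orth gens" "dag N x \<in> orth gens" if "x \<in> orth gens" for x
    using that N_inv[of gens x] dag_inv[of gens x] by blast+
  then have "N x \<in> orth (orth gens)" "dag N x \<in> orth (orth gens)" if "x \<in> orth (orth gens)" for x
    using that N_inv[of "orth gens" x] dag_inv[of "orth gens" x] by blast+
  moreover have "range J \<subseteq> orth (orth gens)"
  proof safe
    fix y show "J y \<in> orth (orth gens)"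
    proof (rule orthI)
      fix m assume "m \<in> orth gens"
      then show "cinner (J y) m = 0" using orthD'[OF _ gensI[of 0 y]] by simp
    qed
  qed
  ultimately have "orth (orth gens) = UNIV" using hilbert_orth by (intro reducing_eq_UNIV) auto
  then have "x \<in> orth (orth gens)" by simp
  from orthD[OF this assms] show "x = 0" by simp
qed

text \<open>The lift is determined by \<open>T (N\<^sup>*\<^sup>k J y) = N\<^sup>*\<^sup>k J (C y)\<close>. On the span of these vectors it is
  symmetric, so the norms of the orbit of a vector are log-convex; growing at most like
  \<open>M\<^sup>i\<close>, where \<open>M\<close> bounds \<open>C\<close>, they give \<open>\<parallel>T u\<parallel> \<le> M \<parallel>u\<parallel>\<close>.\<close>

lemma lift_commutant:
  assumes C: "selfadjoint C" "\<And>y. C (S y) = S (C y)"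
  obtains T where "selfadjoint T" "\<And>k y. T ((dag N ^^ k) (J y)) = (dag N ^^ k) (J (C y))"
    "\<And>x. T (N x) = N (T x)"
proof -
  have cC: "clin C" using C(1) by (rule selfadjoint_clin)
  define W where "W k y = (dag N ^^ k) (J y)" for k y
  have cW: "clin (W k)" for k
    unfolding W_def by (rule clin_compose[OF clin_funpow[OF clin_dag[OF clin_N]] clin_J])
  obtain M where M: "M > 0" "\<And>y. norm (C y) \<le> M * norm y" using clin_bound[OF cC] by blast
  define Gs where "Gs = {(W k y, W k (C y)) |k y. True}"
  define G where "G = span Gs"
  have G: "subspace G" by (simp add: G_def)
  have Nk_J: "(N ^^ k) (J y) = J ((S ^^ k) y)" for k y by (induction k) (simp_all add: J_S)
  \<comment> \<open>Normality lets the adjoint powers change sides, so the Gram matrix of the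
    generators depends on \<open>S\<close> alone; symmetry of \<open>C\<close> can then be used in
    the original space.\<close>
  have Na_N: "cinner (W k y) (W l z) = cinner ((S ^^ l) y) ((S ^^ k) z)" for k l y z
  proof -
    have "cinner (W k y) (W l z) = cinner ((dag N ^^ k) ((N ^^ l) (J y))) (J z)"
      unfolding W_def cinner_funpow_dag[OF clin_N]
      by (simp add: funpow_commute[of "N ^^ l" "dag N"] funpow_commute[of "dag N" N, OF normal])
    also have "\<dots> = cinner ((N ^^ l) (J y)) ((N ^^ k) (J z))"
      using arg_cong[OF cinner_funpow_dag[OF clin_N, of "J z" k "(N ^^ l) (J y)"], of cnj]
      by (simp add: cnj_cinner)
    finally show ?thesis by (simp add: Nk_J cinner_J)
  qed
  have symgen: "inner (snd p) (fst q) = inner (fst p) (snd q)" if p: "p \<in> Gs" and q: "q \<in> Gs" for p q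
  proof -
    obtain k y where ky: "p = (W k y, W k (C y))" using p by (auto simp: Gs_def)
    obtain l z where lz: "q = (W l z, W l (C z))" using q by (auto simp: Gs_def)
    have comm: "(S ^^ n) (C y) = C ((S ^^ n) y)" for n y
      using funpow_commute[of C S, OF C(2)] by simp
    show ?thesis by (simp add: ky lz inner_cinner Na_N comm selfadjoint_cinner[OF C(1)])
  qed
  have symgen': "inner (snd p) (fst q) = inner (fst p) (snd q)" if "p \<in> Gs" "q \<in> G" for p q
    using that(2) unfolding G_def
  proof (induction rule: span_induct)
    case base
    show ?case by (auto simp: subspace_def inner_add_right)
  qed (use that(1) symgen in blast)
  have symG: "inner (snd p) (fst q) = inner (fst p) (snd q)" if "p \<in> G" "q \<in> G" for p q
    using that(1) unfolding G_def
  proof (induction rule: span_induct)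
    case base
    show ?case by (auto simp: subspace_def inner_add_left)
  qed (use that(2) symgen' in blast)
  \<comment> \<open>The lift is not yet known to be a function, so
    \<open>p, T p, T\<^sup>2 p, ...\<close> is replaced by a sequence whose consecutive terms lie in
    the graph. The constant \<open>K\<close> may depend on \<open>p\<close>, only the rate
    \<open>M\<close> is common, and this is what survives sums and multiples.\<close>
  define orbit where "orbit p s \<longleftrightarrow> p = (s 0, s 1) \<and> (\<forall>i. (s i, s (Suc i)) \<in> G) \<and>
      (\<exists>K\<ge>0. \<forall>i. norm (s i) \<le> K * M ^ i)" for p and s :: "nat \<Rightarrow> 'c"
  have orbit: "\<exists>s. orbit p s" if "p \<in> G" for p
    using that unfolding G_def
  proof (induction rule: span_induct)
    case base
    show ?case
    proof (rule subspaceI; safe)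
      have "orbit 0 (\<lambda>_. 0)"
        using subspace_0[OF G] by (auto simp: orbit_def zero_prod_def intro!: exI[of _ 0])
      then show "\<exists>s. orbit 0 s" by blast
    next
      fix p q s t assume s: "orbit p s" and t: "orbit q t"
      obtain K where K: "K \<ge> 0" "\<And>i. norm (s i) \<le> K * M ^ i" using s by (auto simp: orbit_def)
      obtain L where L: "L \<ge> 0" "\<And>i. norm (t i) \<le> L * M ^ i" using t by (auto simp: orbit_def)
      have bd: "norm (s i + t i) \<le> (K + L) * M ^ i" for i
        using norm_triangle_ineq[of "s i" "t i"] K(2)[of i] L(2)[of i] by (simp add: distrib_right)
      have "(s i + t i, s (Suc i) + t (Suc i)) \<in> G" for i
        using subspace_add[OF G, of "(s i, s (Suc i))" "(t i, t (Suc i))"] s t by (simp add: orbit_def)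
      moreover have "p + q = (s 0 + t 0, s 1 + t 1)" using s t by (simp add: orbit_def)
      moreover have "\<exists>K\<ge>0. \<forall>i. norm (s i + t i) \<le> K * M ^ i"
        using bd K(1) L(1) by (intro exI[of _ "K + L"]) simp
      ultimately have "orbit (p + q) (\<lambda>i. s i + t i)" by (simp add: orbit_def)
      then show "\<exists>s. orbit (p + q) s" by blast
    next
      fix c p s assume s: "orbit p s"
      obtain K where K: "K \<ge> 0" "\<And>i. norm (s i) \<le> K * M ^ i" using s by (auto simp: orbit_def)
      have bd: "norm (c *\<^sub>R s i) \<le> (\<bar>c\<bar> * K) * M ^ i" for i
        using mult_left_mono[OF K(2)[of i], of "\<bar>c\<bar>"] by (simp add: mult.assoc)
      have "(c *\<^sub>R s i, c *\<^sub>R s (Suc i)) \<in> G" for i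
        using subspace_scale[OF G, of "(s i, s (Suc i))" c] s by (simp add: orbit_def)
      moreover have "c *\<^sub>R p = (c *\<^sub>R s 0, c *\<^sub>R s 1)" using s by (simp add: orbit_def)
      moreover have "\<exists>K\<ge>0. \<forall>i. norm (c *\<^sub>R s i) \<le> K * M ^ i"
        using bd K(1) by (intro exI[of _ "\<bar>c\<bar> * K"]) simp
      ultimately have "orbit (c *\<^sub>R p) (\<lambda>i. c *\<^sub>R s i)" by (simp add: orbit_def)
      then show "\<exists>s. orbit (c *\<^sub>R p) s" by blast
    qed
  next
    case (step p)
    then obtain k y where p: "p = (W k y, W k (C y))" by (auto simp: Gs_def)
    obtain L where L: "L > 0" "\<And>y. norm (W k y) \<le> L * norm y" using clin_bound[OF cW] by blast
    have Ci: "norm ((C ^^ i) y) \<le> M ^ i * norm y" for i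
    proof (induction i)
      case (Suc i)
      have "norm ((C ^^ Suc i) y) \<le> M * norm ((C ^^ i) y)" using M(2) by simp
      also have "\<dots> \<le> M * (M ^ i * norm y)" using M(1) by (intro mult_left_mono Suc) simp
      finally show ?case by simp
    qed simp
    have "norm (W k ((C ^^ i) y)) \<le> (L * norm y) * M ^ i" for i
    proof -
      have "norm (W k ((C ^^ i) y)) \<le> L * norm ((C ^^ i) y)" by (rule L(2))
      also have "\<dots> \<le> L * (M ^ i * norm y)" using L(1) by (intro mult_left_mono Ci) simp
      finally show ?thesis by (simp add: algebra_simps)
    qed
    then have "\<exists>K\<ge>0. \<forall>i. norm (W k ((C ^^ i) y)) \<le> K * M ^ i"
      using L(1) by (intro exI[of _ "L * norm y"]) simp
    moreover have "(W k ((C ^^ i) y), W k ((C ^^ Suc i) y)) \<in> G" for i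
      unfolding G_def by (rule span_base) (auto simp: Gs_def)
    ultimately have "orbit p (\<lambda>i. W k ((C ^^ i) y))" by (simp add: orbit_def p)
    then show ?case by blast
  qed
  have bd: "norm v \<le> M * norm u" if uv: "(u, v) \<in> G" for u v
  proof -
    obtain s where s: "orbit (u, v) s" using orbit[OF uv] by blast
    then obtain K where K: "\<And>i. norm (s i) \<le> K * M ^ i" by (auto simp: orbit_def)
    have "(norm (s (Suc i)))\<^sup>2 \<le> norm (s i) * norm (s (Suc (Suc i)))" for i
    proof -
      have "inner (s (Suc i)) (s (Suc i)) = inner (s i) (s (Suc (Suc i)))"
        using symG[of "(s i, s (Suc i))" "(s (Suc i), s (Suc (Suc i)))"] s by (simp add: orbit_def)
      then show ?thesis
        using norm_cauchy_schwarz[of "s i" "s (Suc (Suc i))"] by (simp add: power2_norm_eq_inner)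
    qed
    then have "norm (s 1) \<le> M * norm (s 0)"
      using K M(1) by (intro log_convex_bound[of "\<lambda>i. norm (s i)"]) auto
    then show ?thesis using s by (simp add: orbit_def)
  qed
  have scale: "(c *\<^sub>C u, c *\<^sub>C v) \<in> G" if "(u, v) \<in> G" for c u v
    using that unfolding G_def
  proof (rule span_pair_scaleC[rotated])
    fix u v assume "(u, v) \<in> Gs"
    then obtain k y where "(u, v) = (W k y, W k (C y))" by (auto simp: Gs_def)
    then have "(c *\<^sub>C u, c *\<^sub>C v) = (W k (c *\<^sub>C y), W k (C (c *\<^sub>C y)))"
      by (simp add: clin_scaleC[OF cW] clin_scaleC[OF cC])
    then show "(c *\<^sub>C u, c *\<^sub>C v) \<in> Gs" unfolding Gs_def by blast
  qed
  have WG: "(W k y, W k (C y)) \<in> G" for k y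
    unfolding G_def by (rule span_base) (auto simp: Gs_def)
  have dense: "closure (fst ` G) = UNIV"
  proof (rule closure_eq_UNIV[OF fst_image_subspace[OF G scale]])
    fix x assume x: "x \<in> orth (fst ` G)"
    have "x \<in> orth gens"
    proof (rule orthI)
      fix m assume "m \<in> gens"
      then obtain k y where "m = W k y" by (auto simp: gens_def W_def)
      then show "cinner x m = 0" using orthD[OF x imageI[OF WG[of k y], of fst]] by simp
    qed
    then show "x = 0" by (rule gens_total)
  qed
  have "\<exists>T. clin T \<and> (\<forall>(x, y)\<in>G. T x = y)"
    by (rule dense_graph_extension[OF G scale bd dense])
  then obtain T where T: "clin T" "\<forall>(x, y)\<in>G. T x = y" by blast
  have TW: "T (W k y) = W k (C y)" for k y using bspec[OF T(2) WG[of k y]] by simp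
  have gensE: "\<exists>k y. g = W k y" if "g \<in> gens" for g using that by (auto simp: gens_def W_def)
  have "dag T = T"
  proof (rule clin_eqI[OF clin_dag[OF T(1)] T(1) _ gens_total])
    fix g assume "g \<in> gens"
    then obtain k y where g: "g = W k y" using gensE by blast
    have "dag T g - T g = 0"
    proof (rule gens_total, rule orthI)
      fix h assume "h \<in> gens"
      then obtain l z where h: "h = W l z" using gensE by blast
      have comm: "(S ^^ n) (C y) = C ((S ^^ n) y)" for n y
        using funpow_commute[of C S, OF C(2)] by simp
      show "cinner (dag T g - T g) h = 0"
        by (simp add: cinner_diff_left cinner_dag'[OF T(1)] g h TW Na_N comm selfadjoint_cinner[OF C(1)])
    qed
    then show "dag T g = T g" by simp
  qed
  then have "selfadjoint T" using T(1) cinner_dag[OF T(1)] by (simp add: selfadjoint_def)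
  moreover have "(\<lambda>x. T (N x)) = (\<lambda>x. N (T x))"
  proof (rule clin_eqI[OF clin_compose[OF T(1) clin_N] clin_compose[OF clin_N T(1)] _ gens_total])
    fix g assume "g \<in> gens"
    then obtain k y where g: "g = W k y" using gensE by blast
    have "N (W k y) = W k (S y)" for y by (simp add: W_def N_gens)
    then show "T (N g) = N (T g)" by (simp add: g TW C(2))
  qed
  then have "T (N x) = N (T x)" for x by (rule fun_cong)
  ultimately show thesis using TW by (intro that[of T]) (auto simp: W_def)
qed

text \<open>A subnormal operator on a finite-dimensional space is normal: \<open>\<parallel>S\<^sup>*b\<parallel> \<le> \<parallel>N\<^sup>*J b\<parallel> = \<parallel>S b\<parallel>\<close>
  for basis vectors \<open>b\<close>, and the squares of both sides have the same sum.\<close>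

lemma surj_J_if_finite_basis:
  fixes B :: "'b set"
  assumes B: "orthonormal_basis UNIV B" "finite B"
  shows "surj J"
proof -
  let ?P = "\<lambda>y. J (dag J y)"
  have cP: "clin ?P" by (rule clin_compose[OF clin_J clin_dag[OF clin_J]])
  have dag_S: "dag S = (\<lambda>x. dag J (dag N (J x)))"
  proof (rule dag_unique[OF clin_S])
    fix x y
    have "cinner (S x) y = cinner (N (J x)) (J y)" by (simp add: J_S[symmetric] cinner_J)
    then show "cinner (S x) y = cinner x (dag J (dag N (J y)))"
      by (simp add: cinner_dag[OF clin_N] cinner_dag[OF clin_J])
  qed
  have parseval: "(norm x)\<^sup>2 = (\<Sum>b\<in>B. (cmod (cinner x b))\<^sup>2)" for x
    by (rule parseval[OF B hilbert_UNIV UNIV_I])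
  \<comment> \<open>Both sums are the squared Hilbert-Schmidt norm, computed by rows and by
    columns.\<close>
  have "(\<Sum>b\<in>B. (norm (S b))\<^sup>2) = (\<Sum>c\<in>B. \<Sum>b\<in>B. (cmod (cinner (S b) c))\<^sup>2)"
    unfolding parseval[of "S _"] by (rule sum.swap)
  also have "\<dots> = (\<Sum>c\<in>B. (norm (dag S c))\<^sup>2)"
    unfolding parseval[of "dag S _"] cinner_dag[OF clin_S]
    by (rule sum.cong[OF refl], rule sum.cong[OF refl]) (simp only: cmod_cinner_commute)
  finally have trace: "(\<Sum>b\<in>B. (norm (S b))\<^sup>2) = (\<Sum>b\<in>B. (norm (dag S b))\<^sup>2)" .
  \<comment> \<open>\<open>dag S b\<close> is the compression of \<open>dag N (J b)\<close>, whose
    norm equals that of \<open>N (J b) = J (S b)\<close> by normality; the defect is the squared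
    length of the part outside the range of \<open>J\<close>.\<close>
  have defect: "(norm (dag N (J b) - ?P (dag N (J b))))\<^sup>2 = (norm (S b))\<^sup>2 - (norm (dag S b))\<^sup>2" for b
  proof -
    let ?y = "dag N (J b)"
    have "cinner (?y - ?P ?y) (?P ?y) = 0"
      by (simp add: clin_diff[OF clin_dag[OF clin_J]] cinner_dag'[OF clin_J, symmetric] dag_J)
    from norm_add_orthogonal[OF this]
    have "(norm (?y - ?P ?y))\<^sup>2 = (norm ?y)\<^sup>2 - (norm (dag J ?y))\<^sup>2" by (simp add: norm_J)
    moreover have "complex_of_real ((norm ?y)\<^sup>2) = complex_of_real ((norm (N (J b)))\<^sup>2)"
      unfolding cinner_self[symmetric]
      by (simp add: cinner_dag'[OF clin_N] cinner_dag[OF clin_N] normal)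
    ultimately show ?thesis unfolding dag_S
      by (simp only: of_real_eq_iff) (simp add: J_S[symmetric] norm_J)
  qed
  have "(\<Sum>b\<in>B. (norm (dag N (J b) - ?P (dag N (J b))))\<^sup>2) = 0"
    by (simp add: defect sum_subtractf trace)
  then have "\<forall>b\<in>B. dag N (J b) = ?P (dag N (J b))"
    by (subst (asm) sum_nonneg_eq_0_iff) (auto simp: B(2))
  then have "(\<lambda>x. dag N (J x)) = (\<lambda>x. ?P (dag N (J x)))"
    using clin_compose[OF clin_dag[OF clin_N] clin_J] B(1)
    by (intro clin_eqI[of _ _ B] clin_compose[OF cP]) (auto simp: orthonormal_basis_iff orth_def)
  then have Na: "dag N (J x) = ?P (dag N (J x))" for x by (rule fun_cong)
  \<comment> \<open>As a fixed-point set of a continuous map the range is closed.\<close>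
  have rng: "range J = {y. ?P y = y}"
  proof safe
    fix x assume "?P x = x"
    then show "x \<in> range J" by (metis rangeI)
  qed (simp add: dag_J)
  have "closed (range J)"
    unfolding rng by (intro closed_Collect_eq continuous_intros clin_continuous_on[OF cP])
  moreover have "x + y \<in> range J" if "x \<in> range J" "y \<in> range J" for x y
    using that by (auto simp: clin_add[OF clin_J, symmetric])
  moreover have "c *\<^sub>C x \<in> range J" if "x \<in> range J" for c x
    using that by (auto simp: clin_scaleC[OF clin_J, symmetric])
  moreover have "0 \<in> range J" using clin_zero[OF clin_J] by (metis rangeI)
  ultimately have hil: "hilbert (range J)" by (simp add: hilbert_def)
  show ?thesis
  proof (rule reducing_eq_UNIV[OF hil])
    show "N x \<in> range J" if "x \<in> range J" for x
      using that by (auto simp: J_S[symmetric])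
    show "dag N x \<in> range J" if x: "x \<in> range J" for x
    proof -
      obtain z where "x = J z" using x by blast
      then show ?thesis using Na[of z] by (metis rangeI)
    qed
  qed simp
qed

section \<open>Equality of the dimensions of the two spaces\<close>

text \<open>\<open>J\<close> maps a basis to an orthonormal set, which gives one inequality. For the
  other, a finite basis makes \<open>J\<close> surjective, and an infinite basis \<open>B\<close>
  has only countably many images under powers of \<open>dag N\<close>, which together are
  total.\<close>

lemma hdim_eq: "hdim (UNIV :: 'c set) =o hdim (UNIV :: 'b set)"
proof -
  obtain B :: "'b set" where B: "orthonormal_basis UNIV B"
    using orthonormal_basis_exists[OF hilbert_UNIV] by blast
  obtain D :: "'c set" where D: "orthonormal_basis UNIV D"
    using orthonormal_basis_exists[OF hilbert_UNIV] by blast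
  have oB: "orthonormal B" and oD: "orthonormal D" using B D by (auto simp: orthonormal_basis_iff)
  have inj: "inj J" by (rule inj_on_inverseI[of _ "dag J"]) (rule dag_J)
  then have JB_card: "|J ` B| =o |B|"
    by (meson card_of_ordIsoI inj_on_imp_bij_betw inj_on_subset ordIso_symmetric subset_UNIV)
  have oJB: "orthonormal (J ` B)"
    using oB inj by (auto simp: orthonormal_def cinner_J dest: injD)
  then have "|J ` B| \<le>o |D|" by (intro card_orthonormal_le_basis[OF D hilbert_UNIV]) auto
  with JB_card have BD: "|B| \<le>o |D|" using ordIso_ordLeq_trans ordIso_symmetric by blast
  have DB: "|D| \<le>o |B|"
  proof (cases "finite B")
    case True
    have "x = 0" if x: "\<forall>b\<in>J ` B. cinner x b = 0" for x
    proof -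
      obtain y where y: "x = J y" using surj_J_if_finite_basis[OF B True] by (metis surjD)
      then have "\<forall>b\<in>B. cinner y b = 0" using x by (simp add: cinner_J)
      then have "y = 0" using B by (auto simp: orthonormal_basis_iff)
      then show ?thesis by (simp add: y clin_zero[OF clin_J])
    qed
    then have "orthonormal_basis UNIV (J ` B)" using oJB by (simp add: orthonormal_basis_iff)
    then have "|D| \<le>o |J ` B|" using hilbert_UNIV oD subset_UNIV by (rule card_orthonormal_le_basis)
    then show ?thesis using JB_card by (rule ordLeq_ordIso_trans)
  next
    case False
    define Q where "Q = (\<lambda>(b, k). (dag N ^^ k) (J b)) ` (B \<times> (UNIV :: nat set))"
    have "\<exists>q\<in>Q. cinner q d \<noteq> 0" if d: "d \<in> D" for d
    proof (rule ccontr)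
      assume no: "\<not> ?thesis"
      have "dag J ((N ^^ k) d) = 0" for k
      proof -
        have "cinner (dag J ((N ^^ k) d)) b = 0" if "b \<in> B" for b
        proof -
          have "(dag N ^^ k) (J b) \<in> Q" using that by (force simp: Q_def)
          then have "cinner d ((dag N ^^ k) (J b)) = 0"
            using no cinner_eq_zero_commute[of d] by blast
          then show ?thesis by (simp add: cinner_dag'[OF clin_J] cinner_funpow_dag[OF clin_N])
        qed
        then show ?thesis using B by (auto simp: orthonormal_basis_iff)
      qed
      then have "d \<in> orth gens"
        by (intro orthI) (auto simp: gens_def cinner_funpow_dag[OF clin_N] cinner_dag'[OF clin_J, symmetric])
      then have "d = 0" by (rule gens_total)
      then show False using orthonormal_norm[OF oD d] by simp
    qed
    then have "|D| \<le>o |Q \<times> (UNIV :: nat set)|" by (rule card_orthonormal_le_times_nat[OF oD])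
    also have "|Q \<times> (UNIV :: nat set)| \<le>o |(B \<times> (UNIV :: nat set)) \<times> (UNIV :: nat set)|"
      unfolding Q_def by (intro card_of_Times_mono1 card_of_image)
    also have "|(B \<times> (UNIV :: nat set)) \<times> (UNIV :: nat set)| =o |B \<times> (UNIV :: nat set)|"
      using False by (intro card_of_times_nat) (auto simp: finite_cartesian_product_iff)
    also have "|B \<times> (UNIV :: nat set)| =o |B|" using False by (rule card_of_times_nat)
    finally show ?thesis .
  qed
  have "|D| =o |B|" using BD DB by (simp add: ordIso_iff_ordLeq)
  then show ?thesis
    using hdim_ordIso[OF B hilbert_UNIV] hdim_ordIso[OF D hilbert_UNIV]
    by (meson ordIso_symmetric ordIso_transitive)
qed

end

section \<open>Isometries with a unitary and a shift part\<close>

lemma dag_zeroI: "clin A \<Longrightarrow> (\<And>x. cinner w (A x) = 0) \<Longrightarrow> dag A w = 0"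
  using cinner_dag'[of A w "dag A w"] by simp

text \<open>Common powers cancel because \<open>A\<close> is isometric; a remaining power is moved
  across as an adjoint and annihilates the kernel vector.\<close>

lemma wandering:
  assumes A: "clin A" "\<And>x. norm (A x) = norm x" and w: "dag A w = 0" and w': "dag A w' = 0"
  shows "cinner ((A ^^ n) w) ((A ^^ m) w') = (if n = m then cinner w w' else 0)"
proof (induction n arbitrary: m)
  case 0
  show ?case by (cases m) (simp_all add: cinner_dag'[OF A(1), symmetric] w)
next
  case (Suc n)
  show ?case
  proof (cases m)
    case 0
    then show ?thesis by (simp add: cinner_dag[OF A(1)] w')
  next
    case (Suc k)
    then show ?thesis by (simp add: Suc.IH isometry_cinner[OF A])
  qed
qed

text \<open>\<open>Bt\<close> is the prescribed modulus of the operator \<open>Et\<close> to be constructed; minimality of \<open>N\<close>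
  enters only through the last assumption.\<close>

locale brownian_data =
  fixes V :: "'a::chilbert_space \<Rightarrow> 'a" and E :: "'b::chilbert_space \<Rightarrow> 'a"
    and Bt N :: "'c::chilbert_space \<Rightarrow> 'c" and J :: "'b \<Rightarrow> 'c"
  assumes clin_V: "clin V" and norm_V: "norm (V x) = norm x"
    and clin_E: "clin E" and dag_V_E: "dag V (E y) = 0"
    and Bt: "selfadjoint Bt" and clin_N: "clin N"
    and clin_J: "clin J" and norm_J: "norm (J y) = norm y"
    and cinner_Bt_J: "cinner (Bt (J y)) (Bt (J y')) = cinner (E y) (E y')"
    and E_dag_J_zero: "Bt z = 0 \<Longrightarrow> E (dag J z) = 0"
    and Bt_zero: "(\<And>k. E (dag J ((N ^^ k) z)) = 0) \<Longrightarrow> Bt z = 0"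
begin

section \<open>The Wold decomposition of \<open>V\<close>\<close>

text \<open>The unitary part of \<open>V\<close>: the complement of all shifts of
  \<open>ker V\<^sup>*\<close>.\<close>

definition Hu :: "'a set" where
  "Hu = orth {(V ^^ n) w |n w. dag V w = 0}"

text \<open>This is \<open>ker V\<^sup>*\<close> minus the closure of \<open>ran E\<close>, the part
  of the wandering space that must disappear in the extension.\<close>

definition W0 :: "'a set" where
  "W0 = orth (range V \<union> range E)"

text \<open>As \<open>Bt\<close> is self-adjoint, this is the closure of its range.\<close>

definition R :: "'c set" where
  "R = orth {z. Bt z = 0}"

lemma clin_Bt: "clin Bt"
  using Bt by (rule selfadjoint_clin)

lemma dag_V_V: "dag V (V x) = x"
  using isometry_iff_dag[OF clin_V] norm_V by blast

lemma hilbert_parts: "hilbert Hu" "hilbert W0" "hilbert R"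
  by (simp_all add: Hu_def W0_def R_def hilbert_orth)

lemma HuD: "u \<in> Hu \<Longrightarrow> dag V w = 0 \<Longrightarrow> cinner u ((V ^^ n) w) = 0"
  by (auto simp: Hu_def orth_def)

lemma HuI: "(\<And>n w. dag V w = 0 \<Longrightarrow> cinner u ((V ^^ n) w) = 0) \<Longrightarrow> u \<in> Hu"
  by (auto simp: Hu_def orth_def)

lemma wandering_orth_Hu: assumes "dag V w = 0" shows "(V ^^ n) w \<in> orth Hu"
proof (rule orthI)
  fix u assume "u \<in> Hu"
  then show "cinner ((V ^^ n) w) u = 0"
    using HuD[OF _ assms] cinner_eq_zero_commute[of u] by blast
qed

lemma V_Hu: assumes "u \<in> Hu" shows "V u \<in> Hu"
proof (rule HuI)
  fix n w assume w: "dag V w = 0"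
  show "cinner (V u) ((V ^^ n) w) = 0"
    by (cases n) (simp_all add: cinner_dag[OF clin_V] w dag_V_V HuD[OF assms w])
qed

lemma wandering_part: "dag V (x - V (dag V x)) = 0"
  by (simp add: clin_diff[OF clin_dag[OF clin_V]] dag_V_V)

text \<open>The vector \<open>u - V (dag V u)\<close> lies in \<open>ker V\<^sup>*\<close>, hence is
  orthogonal to \<open>u\<close>, and it is orthogonal to \<open>ran V\<close> as well; so it is
  orthogonal to itself.\<close>

lemma Hu_V: assumes u: "u \<in> Hu" shows "\<exists>u'\<in>Hu. u = V u'"
proof (rule bexI)
  let ?r = "u - V (dag V u)"
  have "cinner u ?r = 0" using HuD[OF u wandering_part[of u], of 0] by simp
  moreover have "cinner (V (dag V u)) ?r = 0" by (simp add: cinner_dag[OF clin_V] wandering_part)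
  ultimately have "cinner ?r ?r = 0" by (simp add: cinner_diff_left)
  then have "?r = 0" by (simp only: cinner_eq_zero_iff)
  then show "u = V (dag V u)" by simp
  show "dag V u \<in> Hu"
  proof (rule HuI)
    fix n w assume "dag V w = 0"
    then show "cinner (dag V u) ((V ^^ n) w) = 0"
      using HuD[OF u, of w "Suc n"] by (simp add: cinner_dag'[OF clin_V])
  qed
qed

lemma W0_dag: assumes "q \<in> W0" shows "dag V q = 0" "dag E q = 0"
  using assms by (auto simp: W0_def orth_def intro!: dag_zeroI clin_V clin_E)

section \<open>Labels for the basis of the shift part and their cardinality\<close>

definition indices :: "'a set \<Rightarrow> 'c set \<Rightarrow> (('a \<times> int) + ('c \<times> nat)) set" where
  "indices Q P = (Q \<times> UNIV) <+> (P \<times> UNIV)"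

lemma indices_Inl: "q \<in> Q \<Longrightarrow> Inl (q, k) \<in> indices Q P"
  and indices_Inr: "p \<in> P \<Longrightarrow> Inr (p, n) \<in> indices Q P"
  by (auto simp: indices_def)

text \<open>The shifts of \<open>W0\<close> and of \<open>ran E\<close> exhaust the non-unitary part
  of \<open>V\<close>. The vectors \<open>E (dag J p)\<close> stand in for all of
  \<open>ran E\<close>, so that the family is indexed by the same labels as the basis to be
  constructed.\<close>

lemma orthogonal_total_in_Hu:
  assumes Q: "orthonormal_basis W0 Q" and P: "orthonormal_basis R P"
    and fQ: "\<And>q n. q \<in> Q \<Longrightarrow> cinner f ((V ^^ n) q) = 0"
    and fP: "\<And>p n. p \<in> P \<Longrightarrow> cinner f ((V ^^ n) (E (dag J p))) = 0"
  shows "f \<in> Hu"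
proof (rule HuI)
  fix n w assume w: "dag V w = 0"
  define z where "z = (dag V ^^ n) f"
  have z: "cinner f ((V ^^ n) u) = cinner z u" for u
  proof -
    have "cinner u ((dag V ^^ n) f) = cinner ((V ^^ n) u) f" by (rule cinner_funpow_dag[OF clin_V])
    from arg_cong[OF this, of cnj] show ?thesis by (simp add: cnj_cinner z_def)
  qed
  define r where "r = z - V (dag V z)"
  have dr: "dag V r = 0" unfolding r_def by (rule wandering_part)
  have r: "cinner r u = cinner z u" if "dag V u = 0" for u
    using that by (simp add: r_def cinner_diff_left cinner_dag[OF clin_V])
  have rQ: "cinner r q = 0" if q: "q \<in> Q" for q
  proof -
    have "q \<in> W0" using Q q by (auto simp: orthonormal_basis_iff)
    then show ?thesis using r[OF W0_dag(1)] fQ[OF q, of n] z[of q] by simp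
  qed
  have rP: "cinner r (E (dag J p)) = 0" if p: "p \<in> P" for p
    using r[OF dag_V_E] fP[OF p, of n] z[of "E (dag J p)"] by simp
  \<comment> \<open>A vector of \<open>R\<close> orthogonal to the basis \<open>P\<close> vanishes;
    this gives \<open>dag E r = 0\<close> and places \<open>r\<close> in \<open>W0\<close>.\<close>
  have "J (dag E r) \<in> R" unfolding R_def
  proof (rule orthI)
    fix y assume "y \<in> {z. Bt z = 0}"
    then have "E (dag J y) = 0" using E_dag_J_zero by simp
    then show "cinner (J (dag E r)) y = 0"
      by (simp add: cinner_dag[OF clin_J] cinner_dag'[OF clin_E])
  qed
  moreover have "\<forall>p\<in>P. cinner (J (dag E r)) p = 0"
    using rP by (simp add: cinner_dag[OF clin_J] cinner_dag'[OF clin_E])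
  ultimately have "J (dag E r) = 0" using P by (auto simp: orthonormal_basis_iff)
  then have "dag E r = 0" using norm_J[of "dag E r"] by simp
  then have "r \<in> W0" using dr
    by (auto simp: W0_def orth_def cinner_dag'[OF clin_V, symmetric] cinner_dag'[OF clin_E, symmetric])
  then have "r = 0" using Q rQ by (auto simp: orthonormal_basis_iff)
  then show "cinner f ((V ^^ n) w) = 0" using r[OF w] z[of w] by simp
qed

lemma finite_indices: "finite (indices Q P) \<Longrightarrow> indices Q P = {}"
  by (auto simp: indices_def finite_cartesian_product_iff finite_Plus_iff)

lemma card_indices_le:
  assumes F: "infinite F" and Q: "|Q| \<le>o |F|" and P: "|P| \<le>o |F|"
  shows "|indices Q P| \<le>o |F|"
proof -
  have nat: "|UNIV :: nat set| \<le>o |F|" using F by (simp add: infinite_iff_card_of_nat)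
  have "|UNIV :: int set| \<le>o |UNIV :: nat set|"
    by (rule card_of_ordLeqI[of to_nat]) (auto intro: inj_to_nat)
  with nat have int: "|UNIV :: int set| \<le>o |F|" using ordLeq_transitive by blast
  have Field: "\<not> finite (Field |F| )" using F by (simp add: Field_card_of)
  have "|Q \<times> (UNIV :: int set)| \<le>o |F|" "|P \<times> (UNIV :: nat set)| \<le>o |F|"
    using card_of_Times_ordLeq_infinite_Field[OF Field _ _ card_of_Card_order] Q P int nat by blast+
  then show ?thesis
    unfolding indices_def using card_of_Plus_ordLeq_infinite_Field[OF Field _ _ card_of_Card_order] by blast
qed

text \<open>The orbit of a unit vector of \<open>ker V\<^sup>*\<close> is an infinite orthonormal
  set.\<close>

lemma wandering_infinite:
  assumes F: "orthonormal_basis (orth Hu) F" and w: "dag V w = 0" "w \<noteq> 0"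
  shows "infinite F"
proof -
  define e where "e = complex_of_real (inverse (norm w)) *\<^sub>C w"
  have "norm e = 1" using w(2) by (simp add: e_def norm_scaleC norm_inverse)
  then have ee: "cinner e e = 1" by (simp add: cinner_self)
  have de: "dag V e = 0" using w(1) by (simp add: e_def clin_scaleC[OF clin_dag[OF clin_V]])
  define f where "f n = (V ^^ n) e" for n
  have gram: "cinner (f n) (f m) = (if n = m then 1 else 0)" for n m
    using wandering[OF clin_V norm_V de de] ee by (simp add: f_def)
  then have inj: "inj f" by (metis inj_onI zero_neq_one)
  have "orthonormal (range f)"
    unfolding orthonormal_def using gram inj by (auto dest: injD)
  moreover have "range f \<subseteq> orth Hu" using wandering_orth_Hu[OF de] by (auto simp: f_def)
  ultimately have "|range f| \<le>o |F|" by (rule card_orthonormal_le_basis[OF F hilbert_orth])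
  moreover have "infinite (range f)" using inj by (simp add: finite_image_iff)
  ultimately show ?thesis using card_of_ordLeq_finite by blast
qed

text \<open>Here the dimension is kept from growing. Both inequalities between the cardinals come
  from the counting principle together with the infinity of \<open>F\<close>; without wandering
  vectors all the sets involved are empty.\<close>

lemma basis_bijection:
  assumes F: "orthonormal_basis (orth Hu) F"
    and Q: "orthonormal_basis W0 Q" and P: "orthonormal_basis R P"
  shows "\<exists>\<pi>. bij_betw \<pi> (indices Q P) F"
proof -
  have oF: "orthonormal F" "F \<subseteq> orth Hu" and oQ: "orthonormal Q" "Q \<subseteq> W0"
    and oP: "orthonormal P" "P \<subseteq> R"
    using F Q P by (auto simp: orthonormal_basis_iff)
  have f_nonzero: "f \<noteq> 0" if "f \<in> F" for f using orthonormal_norm[OF oF(1) that] by auto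
  have "W0 \<subseteq> orth Hu" using wandering_orth_Hu[OF W0_dag(1), of _ 0] by auto
  then have QF: "|Q| \<le>o |F|" using oQ by (intro card_orthonormal_le_basis[OF F hilbert_orth]) auto
  \<comment> \<open>The operators \<open>A k\<close> have no common kernel vector in
    \<open>R\<close> except zero, by \<open>Bt_zero\<close>. So each \<open>p\<close> meets one of
    the vectors \<open>dag (A k) f\<close>, which are countably many for each
    \<open>f\<close>.\<close>
  define A where "A k z = E (dag J ((N ^^ k) z))" for k z
  have cA: "clin (A k)" for k
    unfolding A_def
    by (intro clin_compose[OF clin_E] clin_compose[OF clin_dag[OF clin_J]] clin_funpow clin_N)
  define D where "D = (\<lambda>(f, k). dag (A k) f) ` (F \<times> (UNIV :: nat set))"
  have "\<exists>d\<in>D. cinner d p \<noteq> 0" if p: "p \<in> P" for p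
  proof (rule ccontr)
    assume no: "\<not> ?thesis"
    have "A k p = 0" for k
    proof -
      have "cinner (A k p) f = 0" if "f \<in> F" for f
      proof -
        have "dag (A k) f \<in> D" using that by (force simp: D_def)
        then have "cinner p (dag (A k) f) = 0" using no cinner_eq_zero_commute[of p] by blast
        then show ?thesis by (simp add: cinner_dag[OF cA])
      qed
      moreover have "A k p \<in> orth Hu" using wandering_orth_Hu[OF dag_V_E, of 0] by (simp add: A_def)
      ultimately show ?thesis using F by (auto simp: orthonormal_basis_iff)
    qed
    then have "Bt p = 0" by (intro Bt_zero) (simp add: A_def)
    moreover have "p \<in> R" using oP p by blast
    ultimately have "p = 0" using orthD[of p "{z. Bt z = 0}" p] by (simp add: R_def)
    then show False using orthonormal_norm[OF oP(1) p] by simp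
  qed
  then have "|P| \<le>o |D \<times> (UNIV :: nat set)|" by (rule card_orthonormal_le_times_nat[OF oP(1)])
  also have "|D \<times> (UNIV :: nat set)| \<le>o |(F \<times> (UNIV :: nat set)) \<times> (UNIV :: nat set)|"
    unfolding D_def by (intro card_of_Times_mono1 card_of_image)
  finally have PF: "|P| \<le>o |(F \<times> (UNIV :: nat set)) \<times> (UNIV :: nat set)|" .
  \<comment> \<open>Only the image of \<open>g\<close> matters: it must meet every \<open>f\<close>.
    That \<open>nat k\<close> sends all negative \<open>k\<close> to zero does no harm.\<close>
  define g where "g i = (case i of Inl (q, k) \<Rightarrow> (V ^^ nat k) q
      | Inr (p, n) \<Rightarrow> (V ^^ n) (E (dag J p)))" for i :: "('a \<times> int) + ('c \<times> nat)"
  let ?X = "indices Q P"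
  have g: "\<exists>d\<in>g ` ?X. cinner d f \<noteq> 0" if f: "f \<in> F" for f
  proof (rule ccontr)
    assume no: "\<not> ?thesis"
    have no: "cinner f (g i) = 0" if "i \<in> ?X" for i
      using no that cinner_eq_zero_commute[of f] by blast
    have "f \<in> Hu"
    proof (rule orthogonal_total_in_Hu[OF Q P])
      show "cinner f ((V ^^ n) q) = 0" if "q \<in> Q" for q n
        using no[OF indices_Inl[OF that], of "int n"] by (simp add: g_def)
      show "cinner f ((V ^^ n) (E (dag J p))) = 0" if "p \<in> P" for p n
        using no[OF indices_Inr[OF that], of n] by (simp add: g_def)
    qed
    moreover have "f \<in> orth Hu" using oF f by blast
    ultimately show False using orthD[of f Hu f] f_nonzero[OF f] by simp
  qed
  have "|?X| =o |F|"
  proof (cases "\<exists>w. dag V w = 0 \<and> w \<noteq> 0")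
    case True
    then have inf: "infinite F" using wandering_infinite[OF F] by blast
    have "|(F \<times> (UNIV :: nat set)) \<times> (UNIV :: nat set)| =o |F \<times> (UNIV :: nat set)|"
      using inf by (intro card_of_times_nat) (auto simp: finite_cartesian_product_iff)
    then have "|(F \<times> (UNIV :: nat set)) \<times> (UNIV :: nat set)| =o |F|"
      using card_of_times_nat[OF inf] by (rule ordIso_transitive)
    with PF have "|P| \<le>o |F|" by (rule ordLeq_ordIso_trans)
    then have le: "|?X| \<le>o |F|" by (rule card_indices_le[OF inf QF])
    have "F \<noteq> {}" using inf by auto
    then have "?X \<noteq> {}" using g by auto
    then have infX: "infinite ?X" using finite_indices by blast
    have "|F| \<le>o |g ` ?X \<times> (UNIV :: nat set)|" by (rule card_orthonormal_le_times_nat[OF oF(1) g])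
    also have "|g ` ?X \<times> (UNIV :: nat set)| \<le>o |?X \<times> (UNIV :: nat set)|"
      by (intro card_of_Times_mono1 card_of_image)
    also have "|?X \<times> (UNIV :: nat set)| =o |?X|" using infX by (rule card_of_times_nat)
    finally show ?thesis using le by (simp add: ordIso_iff_ordLeq)
  next
    \<comment> \<open>Now \<open>V\<close> is unitary and \<open>Hu\<close> is everything, so
      \<open>F\<close> is empty, and the estimates for \<open>P\<close> and \<open>Q\<close> make
      them empty too.\<close>
    case False
    have all: "x \<in> Hu" for x
    proof (rule HuI)
      fix n w assume "dag V w = 0"
      then have "w = 0" using False by blast
      then show "cinner x ((V ^^ n) w) = 0" by (simp add: clin_zero[OF clin_funpow[OF clin_V]])
    qed
    have "x = 0" if "x \<in> orth Hu" for x using orthD[OF that all[of x]] by simp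
    then have "F = {}" using oF(2) f_nonzero by blast
    moreover from this have "P = {}" using PF by (simp add: card_of_empty3)
    moreover have "Q = {}" using QF \<open>F = {}\<close> by (simp add: card_of_empty3)
    ultimately have "?X = {}" by (auto simp: indices_def)
    then show ?thesis using \<open>F = {}\<close> by (simp add: card_of_empty_ordIso)
  qed
  then show ?thesis by (simp only: card_of_ordIso)
qed

text \<open>Membership of \<open>t\<close> in the closed span of \<open>P\<close>, in the
  double-orthogonality form required by \<open>gram_extension\<close>.\<close>

lemma cinner_R_basis:
  assumes P: "orthonormal_basis R P" and t: "t \<in> R" and u: "\<And>p. p \<in> P \<Longrightarrow> cinner u p = 0"
  shows "cinner t u = 0"
proof -
  obtain a b where ab: "a \<in> R" "b \<in> orth R" "u = a + b"
    using orth_decompose[OF hilbert_parts(3)] by blast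
  have "\<forall>p\<in>P. cinner a p = 0"
  proof
    fix p assume p: "p \<in> P"
    then have "cinner b p = 0" using P orthD[OF ab(2), of p] by (auto simp: orthonormal_basis_iff)
    then show "cinner a p = 0" using u[OF p] by (simp add: ab(3) cinner_add_left)
  qed
  then have "a = 0" using P ab(1) by (auto simp: orthonormal_basis_iff)
  then show ?thesis using orthD'[OF ab(2) t] by (simp add: ab(3))
qed

lemma Bt_in_R: "Bt x \<in> R"
  unfolding R_def by (rule orthI) (simp add: selfadjoint_cinner[OF Bt])

section \<open>Construction of the extended isometry, the operator and the embedding\<close>

fun shift :: "('a \<times> int) + ('c \<times> nat) \<Rightarrow> ('a \<times> int) + ('c \<times> nat)" where
  "shift (Inl (q, k)) = Inl (q, k + 1)"
| "shift (Inr (p, n)) = Inr (p, Suc n)"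

lemma shift_inj: "shift i = shift j \<longleftrightarrow> i = j"
  by (cases i; cases j; auto)

lemma shift_indices: "i \<in> indices Q P \<Longrightarrow> shift i \<in> indices Q P"
  by (auto simp: indices_def)

text \<open>On integer labels the shift is onto, so outside its range there are only the
  \<open>Inr (p, 0)\<close>; these will generate \<open>ker Vt\<^sup>*\<close>.\<close>

lemma shift_cases:
  assumes "i \<in> indices Q P"
  obtains j where "j \<in> indices Q P" "i = shift j" | p where "p \<in> P" "i = Inr (p, 0)"
proof (cases i)
  case (Inl z)
  obtain q k where z: "z = (q, k)" by (cases z)
  show thesis
    using that(1)[of "Inl (q, k - 1)"] assms Inl z by (auto simp: indices_def)
next
  case (Inr z)
  obtain p n where z: "z = (p, n)" by (cases z)
  show thesis
    using that(1)[of "Inr (p, n - 1)"] that(2)[of p] assms Inr z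
    by (cases n) (auto simp: indices_def)
qed

text \<open>The Gram condition encodes \<open>|Et| = Bt\<close>. The final clause is the range
  decomposition in dual form: nothing is orthogonal to both \<open>ran Vt\<close> and
  \<open>ran Et\<close>.\<close>

definition normal_model :: "('a \<Rightarrow> 'a) \<Rightarrow> ('c \<Rightarrow> 'a) \<Rightarrow> ('a \<Rightarrow> 'a) \<Rightarrow> bool" where
  "normal_model Vt Et J1 \<longleftrightarrow> clin Vt \<and> clin Et \<and> clin J1 \<and>
     (\<forall>x. norm (Vt x) = norm x) \<and> (\<forall>x. norm (J1 x) = norm x) \<and>
     (\<forall>x y. cinner (Et x) (Et y) = cinner (Bt x) (Bt y)) \<and> (\<forall>y. dag Vt (Et y) = 0) \<and>
     (\<forall>x. J1 (V x) = Vt (J1 x)) \<and> (\<forall>y. J1 (E y) = Et (J y)) \<and>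
     (\<forall>z. dag Vt z = 0 \<longrightarrow> dag Et z = 0 \<longrightarrow> z = 0)"

text \<open>The space is split into the unitary part \<open>Hu\<close> of \<open>V\<close> and \<open>orth Hu\<close>, whose basis is
  indexed by \<open>Q \<times> int\<close> (bilateral shifts, extending the part of \<open>V\<close> generated by \<open>W0\<close>) and
  \<open>P \<times> nat\<close> (unilateral shifts, generated by the range of \<open>Et\<close>).\<close>

lemma normal_model_exists: "\<exists>Vt Et J1. normal_model Vt Et J1"
proof -
  obtain F where F: "orthonormal_basis (orth Hu) F"
    using orthonormal_basis_exists[OF hilbert_orth] by blast
  obtain Q where Q: "orthonormal_basis W0 Q"
    using orthonormal_basis_exists[OF hilbert_parts(2)] by blast
  obtain P where P: "orthonormal_basis R P"
    using orthonormal_basis_exists[OF hilbert_parts(3)] by blast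
  let ?X = "indices Q P"
  obtain \<pi> where \<pi>: "bij_betw \<pi> ?X F" using basis_bijection[OF F Q P] by blast
  have \<pi>F: "\<pi> i \<in> F" if "i \<in> ?X" for i using \<pi> that by (auto simp: bij_betw_def)
  have \<pi>_orth: "\<pi> i \<in> orth Hu" if "i \<in> ?X" for i
    using \<pi>F[OF that] F by (auto simp: orthonormal_basis_iff)
  have \<pi>_gram: "cinner (\<pi> i) (\<pi> j) = (if i = j then 1 else 0)" if "i \<in> ?X" "j \<in> ?X" for i j
  proof -
    have "\<pi> i = \<pi> j \<longleftrightarrow> i = j" using \<pi> that by (auto simp: bij_betw_def dest: inj_onD)
    then show ?thesis using \<pi>F[OF that(1)] \<pi>F[OF that(2)] F
      by (simp add: orthonormal_basis_iff orthonormal_def)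
  qed
  have u\<pi>: "cinner u (\<pi> i) = 0" "cinner (\<pi> i) u = 0" if "u \<in> Hu" "i \<in> ?X" for u i
    using orthD[OF \<pi>_orth[OF that(2)] that(1)] orthD'[OF \<pi>_orth[OF that(2)] that(1)] by auto
  have total: "z = 0" if "\<And>u. u \<in> Hu \<Longrightarrow> cinner z u = 0" "\<And>i. i \<in> ?X \<Longrightarrow> cinner z (\<pi> i) = 0" for z
  proof -
    have "z \<in> orth Hu" by (rule orthI) (rule that(1))
    moreover have "\<forall>f\<in>F. cinner z f = 0" using that(2) \<pi> by (auto simp: bij_betw_def)
    ultimately show ?thesis using F by (auto simp: orthonormal_basis_iff)
  qed

  \<comment> \<open>\<open>Vt\<close> acts as \<open>V\<close> on the unitary part and as the shift
    of labels on the basis of its complement.\<close>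
  define src where "src = case_sum (\<lambda>u. u) \<pi>"
  define tgt where "tgt = case_sum V (\<lambda>i. \<pi> (shift i))"
  have "cinner (src i) (src j) = cinner (tgt i) (tgt j)" if "i \<in> Hu <+> ?X" "j \<in> Hu <+> ?X" for i j
    using that
    by (auto simp: src_def tgt_def isometry_cinner[OF clin_V norm_V] u\<pi> V_Hu shift_indices \<pi>_gram shift_inj)
  then obtain Vt where Vt: "clin Vt" and Vt_src: "\<And>i. i \<in> Hu <+> ?X \<Longrightarrow> Vt (src i) = tgt i"
    and Vt_norm: "\<And>v. (\<And>u. (\<And>i. i \<in> Hu <+> ?X \<Longrightarrow> cinner u (src i) = 0) \<Longrightarrow> cinner v u = 0)
      \<Longrightarrow> norm (Vt v) = norm v"
    using gram_extension[of "Hu <+> ?X" src tgt] by blast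
  have Vt_Hu: "Vt u = V u" if "u \<in> Hu" for u
    using Vt_src[OF InlI[OF that]] by (simp add: src_def tgt_def)
  have Vt_\<pi>: "Vt (\<pi> i) = \<pi> (shift i)" if "i \<in> ?X" for i
    using Vt_src[OF InrI[OF that]] by (simp add: src_def tgt_def)
  have norm_Vt: "norm (Vt x) = norm x" for x
  proof (rule Vt_norm)
    fix u assume u: "\<And>i. i \<in> Hu <+> ?X \<Longrightarrow> cinner u (src i) = 0"
    have "u = 0"
    proof (rule total)
      show "cinner u v = 0" if "v \<in> Hu" for v using u[OF InlI[OF that]] by (simp add: src_def)
      show "cinner u (\<pi> i) = 0" if "i \<in> ?X" for i using u[OF InrI[OF that]] by (simp add: src_def)
    qed
    then show "cinner x u = 0" by simp
  qed
  note iso_Vt = isometry_cinner[OF Vt norm_Vt]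
  have Hu_Vt: "\<exists>u'\<in>Hu. u = Vt u'" if "u \<in> Hu" for u
    using Hu_V[OF that] Vt_Hu by force

  have oP: "orthonormal P" "P \<subseteq> R" using P by (auto simp: orthonormal_basis_iff)
  have Pgram: "cinner p p' = cinner (\<pi> (Inr (p, 0))) (\<pi> (Inr (p', 0)))" if "p \<in> P" "p' \<in> P" for p p'
    using that oP(1) by (simp add: \<pi>_gram indices_Inr orthonormal_def)
  obtain U where U: "clin U" and U_P: "\<And>p. p \<in> P \<Longrightarrow> U p = \<pi> (Inr (p, 0))"
    and U_norm: "\<And>v. (\<And>u. (\<And>p. p \<in> P \<Longrightarrow> cinner u p = 0) \<Longrightarrow> cinner v u = 0) \<Longrightarrow> norm (U v) = norm v"
    using gram_extension[of P "\<lambda>p. p" "\<lambda>p. \<pi> (Inr (p, 0))", OF Pgram] by blast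
  \<comment> \<open>A polar decomposition: \<open>U\<close> is isometric on \<open>R\<close> and
    takes its basis to the generators of the unilateral shifts.\<close>
  define Et where "Et x = U (Bt x)" for x
  have Et: "clin Et" unfolding Et_def by (rule clin_compose[OF U clin_Bt])
  have norm_Et: "norm (Et x) = norm (Bt x)" for x
    unfolding Et_def by (rule U_norm) (rule cinner_R_basis[OF P Bt_in_R])
  have Et_gram: "cinner (Et x) (Et y) = cinner (Bt x) (Bt y)" for x y
    using norm_eq_imp_cinner_eq[OF Et clin_Bt norm_Et] .
  have Vt_UP: "dag Vt (\<pi> (Inr (p, 0))) = 0" if p: "p \<in> P" for p
  proof (rule total)
    note i = indices_Inr[OF p, of 0 Q]
    show "cinner (dag Vt (\<pi> (Inr (p, 0)))) u = 0" if "u \<in> Hu" for u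
      by (simp add: cinner_dag'[OF Vt] Vt_Hu that u\<pi> V_Hu i)
    have ne: "Inr (p, 0) \<noteq> shift j" for j by (cases j rule: shift.cases) auto
    show "cinner (dag Vt (\<pi> (Inr (p, 0)))) (\<pi> j) = 0" if "j \<in> ?X" for j
      by (simp add: cinner_dag'[OF Vt] Vt_\<pi> that \<pi>_gram shift_indices i ne)
  qed
  have Vt_Et: "dag Vt (Et y) = 0" for y
  proof (rule dag_zeroI[OF Vt])
    fix x
    have "cinner (Bt y) (dag U (Vt x)) = 0"
    proof (rule cinner_R_basis[OF P Bt_in_R])
      fix p assume p: "p \<in> P"
      have "cinner (Vt x) (U p) = 0" by (simp add: U_P p cinner_dag[OF Vt] Vt_UP)
      then show "cinner (dag U (Vt x)) p = 0" by (simp add: cinner_dag'[OF U])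
    qed
    then show "cinner (Et y) (Vt x) = 0" by (simp add: Et_def cinner_dag[OF U])
  qed

  have Vt_orth: "(Vt ^^ n) (Et y) \<in> orth Hu" for n y
  proof (induction n)
    case 0
    show ?case
    proof (rule orthI)
      fix u assume "u \<in> Hu"
      then obtain u' where "u = Vt u'" using Hu_Vt by blast
      then show "cinner ((Vt ^^ 0) (Et y)) u = 0" by (simp add: cinner_dag'[OF Vt, symmetric] Vt_Et)
    qed
  next
    case (Suc n)
    show ?case
    proof (rule orthI)
      fix u assume "u \<in> Hu"
      then obtain u' where "u' \<in> Hu" "u = Vt u'" using Hu_Vt by blast
      then show "cinner ((Vt ^^ Suc n) (Et y)) u = 0" using orthD[OF Suc] by (simp add: iso_Vt)
    qed
  qed
  have Vt_iterate: "\<pi> (Inl (q, k + int m)) = (Vt ^^ m) (\<pi> (Inl (q, k)))" if "q \<in> Q" for q k m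
  proof (induction m)
    case (Suc m)
    have "\<pi> (Inl (q, k + int (Suc m))) = Vt (\<pi> (Inl (q, k + int m)))"
      by (simp add: Vt_\<pi> indices_Inl that algebra_simps)
    then show ?case by (simp add: Suc)
  qed simp
  have funpow_Vt: "cinner ((Vt ^^ m) x) ((Vt ^^ m) y) = cinner x y" for m x y
    by (induction m) (simp_all add: iso_Vt)
  \<comment> \<open>In a bilateral shift one can go back \<open>m\<close> steps and one more, so the
    vector reached lies in \<open>ran Vt\<close>, which is orthogonal to
    \<open>ran Et\<close>.\<close>
  have \<pi>Q_Et: "cinner (\<pi> (Inl (q, k))) ((Vt ^^ m) (Et y)) = 0" if "q \<in> Q" for q k m y
  proof -
    have "cinner (\<pi> (Inl (q, k))) ((Vt ^^ m) (Et y)) = cinner (\<pi> (Inl (q, k - int m))) (Et y)"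
      using Vt_iterate[OF that, of "k - int m" m] by (simp add: funpow_Vt)
    also have "\<pi> (Inl (q, k - int m)) = Vt (\<pi> (Inl (q, k - int m - 1)))"
      using Vt_iterate[OF that, of "k - int m - 1" 1] by simp
    also have "cinner (Vt (\<pi> (Inl (q, k - int m - 1)))) (Et y) = 0"
      by (simp add: cinner_dag[OF Vt] Vt_Et)
    finally show ?thesis .
  qed

  \<comment> \<open>\<open>J1\<close> follows the Wold decomposition of \<open>V\<close>: the orbit
    of \<open>q\<close> goes to the nonnegative half of a bilateral shift, the orbit of
    \<open>E y\<close> to that of \<open>Et (J y)\<close>. The vectors \<open>E y\<close> are not
    orthonormal, so matching Gram matrices replaces matching bases.\<close>
  define src1 :: "'a + ('a \<times> nat) + ('b \<times> nat) \<Rightarrow> 'a"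
    where "src1 = case_sum (\<lambda>u. u) (case_sum (\<lambda>(q, n). (V ^^ n) q) (\<lambda>(y, n). (V ^^ n) (E y)))"
  define tgt1 :: "'a + ('a \<times> nat) + ('b \<times> nat) \<Rightarrow> 'a"
    where "tgt1 = case_sum (\<lambda>u. u)
      (case_sum (\<lambda>(q, n). \<pi> (Inl (q, int n))) (\<lambda>(y, n). (Vt ^^ n) (Et (J y))))"
  define I where "I = Hu <+> (Q \<times> (UNIV :: nat set)) <+> ((UNIV :: 'b set) \<times> (UNIV :: nat set))"
  have Q_W: "dag V q = 0" "dag E q = 0" if "q \<in> Q" for q
    using W0_dag[of q] Q that by (auto simp: orthonormal_basis_iff)
  have oQ: "orthonormal Q" using Q by (simp add: orthonormal_basis_iff)
  define good where "good i j \<longleftrightarrow> cinner (src1 i) (src1 j) = cinner (tgt1 i) (tgt1 j)" for i j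
  have sym: "good j i" if "good i j" for i j
    using arg_cong[of _ _ cnj, OF that[unfolded good_def]] by (simp add: good_def cnj_cinner)
  have uu: "good (Inl u) (Inl v)" for u v by (simp add: good_def src1_def tgt1_def)
  have uq: "good (Inl u) (Inr (Inl (q, n)))" if "u \<in> Hu" "q \<in> Q" for u q n
    by (simp add: good_def src1_def tgt1_def HuD that Q_W u\<pi> indices_Inl)
  have ue: "good (Inl u) (Inr (Inr (y, n)))" if "u \<in> Hu" for u y n
    using orthD'[OF Vt_orth that] by (simp add: good_def src1_def tgt1_def HuD that dag_V_E)
  have qq: "good (Inr (Inl (q, n))) (Inr (Inl (q', m)))" if "q \<in> Q" "q' \<in> Q" for q q' n m
    using that oQ
    by (simp add: good_def src1_def tgt1_def wandering[OF clin_V norm_V] Q_W \<pi>_gram indices_Inl orthonormal_def)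
  have qe: "good (Inr (Inl (q, n))) (Inr (Inr (y, m)))" if "q \<in> Q" for q n y m
    by (simp add: good_def src1_def tgt1_def wandering[OF clin_V norm_V] Q_W that dag_V_E \<pi>Q_Et
        cinner_dag'[OF clin_E, symmetric])
  have ee: "good (Inr (Inr (y, n))) (Inr (Inr (y', m)))" for y y' n m
    by (simp add: good_def src1_def tgt1_def wandering[OF clin_V norm_V] dag_V_E
        wandering[OF Vt norm_Vt] Vt_Et Et_gram cinner_Bt_J)
  have "good i j" if "i \<in> I" "j \<in> I" for i j
    using that uu uq ue qq qe ee uq[THEN sym] ue[THEN sym] qe[THEN sym] by (auto simp: I_def)
  then obtain J1 where J1: "clin J1" and J1_src: "\<And>i. i \<in> I \<Longrightarrow> J1 (src1 i) = tgt1 i"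
    and J1_norm: "\<And>v. (\<And>u. (\<And>i. i \<in> I \<Longrightarrow> cinner u (src1 i) = 0) \<Longrightarrow> cinner v u = 0)
      \<Longrightarrow> norm (J1 v) = norm v"
    using gram_extension[of I src1 tgt1] unfolding good_def by blast
  have J1_Hu: "J1 u = u" if "u \<in> Hu" for u
    using J1_src[of "Inl u"] that by (auto simp: I_def src1_def tgt1_def)
  have J1_Q: "J1 ((V ^^ n) q) = \<pi> (Inl (q, int n))" if "q \<in> Q" for q n
    using J1_src[of "Inr (Inl (q, n))"] that by (auto simp: I_def src1_def tgt1_def)
  have J1_E: "J1 ((V ^^ n) (E y)) = (Vt ^^ n) (Et (J y))" for y n
    using J1_src[of "Inr (Inr (y, n))"] by (auto simp: I_def src1_def tgt1_def)
  have total1: "u = 0" if u: "\<And>i. i \<in> I \<Longrightarrow> cinner u (src1 i) = 0" for u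
  proof -
    have "u \<in> Hu"
    proof (rule orthogonal_total_in_Hu[OF Q P])
      show "cinner u ((V ^^ n) q) = 0" if "q \<in> Q" for q n
        using u[of "Inr (Inl (q, n))"] that by (auto simp: I_def src1_def)
      show "cinner u ((V ^^ n) (E (dag J p))) = 0" for p n
        using u[of "Inr (Inr (dag J p, n))"] by (auto simp: I_def src1_def)
    qed
    then show ?thesis using u[of "Inl u"] by (auto simp: I_def src1_def)
  qed
  have norm_J1: "norm (J1 x) = norm x" for x
    by (rule J1_norm) (use total1 in force)
  have "(\<lambda>x. J1 (V x)) = (\<lambda>x. Vt (J1 x))"
  proof (rule clin_eqI[OF clin_compose[OF J1 clin_V] clin_compose[OF Vt J1], of "src1 ` I"])
    fix d assume "d \<in> src1 ` I"
    then consider u where "u \<in> Hu" "d = u" | q n where "q \<in> Q" "d = (V ^^ n) q"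
      | y n where "d = (V ^^ n) (E y)"
      by (auto simp: I_def src1_def)
    then show "J1 (V d) = Vt (J1 d)"
    proof cases
      case 1
      then show ?thesis by (simp add: J1_Hu V_Hu Vt_Hu)
    next
      case 2
      then show ?thesis using J1_Q[OF 2(1), of "Suc n"] J1_Q[OF 2(1), of n]
        by (simp add: Vt_\<pi> indices_Inl add.commute)
    next
      case 3
      then show ?thesis using J1_E[of "Suc n"] J1_E[of n] by simp
    qed
  next
    fix x assume "x \<in> orth (src1 ` I)"
    then show "x = 0" by (intro total1) (auto simp: orth_def)
  qed
  then have J1_V: "J1 (V x) = Vt (J1 x)" for x by (rule fun_cong)
  have J1_E0: "J1 (E y) = Et (J y)" for y using J1_E[of 0 y] by simp

  \<comment> \<open>Orthogonality to \<open>ran Vt\<close> settles \<open>Hu\<close> and all shifted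
    labels. For \<open>Inr (p, 0)\<close>, the vector \<open>dag U z\<close> lies in
    \<open>ker Bt\<close>, hence is orthogonal to \<open>p\<close>.\<close>
  have final: "z = 0" if z: "dag Vt z = 0" "dag Et z = 0" for z
  proof (rule total)
    have zVt: "cinner z (Vt x) = 0" for x using z(1) by (simp add: cinner_dag'[OF Vt, symmetric])
    show "cinner z u = 0" if "u \<in> Hu" for u using Hu_Vt[OF that] zVt by blast
    have "dag Et z = Bt (dag U z)"
    proof (rule cinner_ext)
      show "cinner (dag Et z) x = cinner (Bt (dag U z)) x" for x
        by (simp add: cinner_dag'[OF Et] Et_def selfadjoint_cinner[OF Bt] cinner_dag'[OF U])
    qed
    then have ker: "Bt (dag U z) = 0" using z(2) by simp
    show "cinner z (\<pi> i) = 0" if i: "i \<in> ?X" for i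
      using i
    proof (cases rule: shift_cases)
      case (1 j)
      then show ?thesis using zVt Vt_\<pi>[of j] by metis
    next
      case (2 p)
      then have "p \<in> R" using oP by blast
      then have "cinner (dag U z) p = 0" using orthD'[of p "{z. Bt z = 0}" "dag U z"] ker by (simp add: R_def)
      then show ?thesis by (simp add: 2(2) cinner_dag'[OF U] U_P[OF 2(1)])
    qed
  qed
  have "normal_model Vt Et J1"
    unfolding normal_model_def
    using Vt Et J1 norm_Vt norm_J1 Et_gram Vt_Et J1_V J1_E0 final by (intro conjI allI impI)
  then show ?thesis by blast
qed

end

text \<open>
  Lifting the square root \<open>C\<close> of \<open>|E|\<close> to a self-adjoint \<open>T\<close>, rather than lifting \<open>|E|\<close> itself,
  makes the positivity of the lift \<open>T\<^sup>2\<close> of \<open>|E|\<close> evident.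
\<close>

theorem corollary1p5:
  fixes V :: "'a::chilbert_space \<Rightarrow> 'a"
    and E :: "'b::chilbert_space \<Rightarrow> 'a"
    and S :: "'b \<Rightarrow> 'b"
    and N :: "'c::chilbert_space \<Rightarrow> 'c"
    and J2 :: "'b \<Rightarrow> 'c"
  assumes "OpMat V E (\<lambda>_. 0) S \<in> brownian_subnormal TYPE('d::chilbert_space) UNIV UNIV"
    and "minimal_normal_extension UNIV S UNIV N J2"
  shows "\<exists>(K1 :: 'a set) (J1 :: 'a \<Rightarrow> 'a) (Vt :: 'a \<Rightarrow> 'a) (Et :: 'c \<Rightarrow> 'a).
    hilbert K1 \<and> Vt \<in> bounded_ops K1 K1 \<and> Et \<in> bounded_ops UNIV K1 \<and>
    OpMat Vt Et (\<lambda>_. 0) N \<in> brownian_normal K1 UNIV \<and>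
    opmat_extension UNIV UNIV (OpMat V E (\<lambda>_. 0) S) K1 UNIV (OpMat Vt Et (\<lambda>_. 0) N) J1 J2 \<and>
    op_extension UNIV (abs_op UNIV UNIV E) UNIV (abs_op UNIV K1 Et) J2 \<and>
    hdim K1 =o hdim (UNIV :: 'a set) \<and>
    hdim (UNIV :: 'c set) =o hdim (UNIV :: 'b set) \<and>
    orthogonal_sum K1 (Vt ` K1) (closure (Et ` UNIV))"
proof -
  have bt: "brownian_type UNIV UNIV (OpMat V E (\<lambda>_. 0) S)"
    using assms(1) by (simp add: brownian_subnormal_def)
  then have V: "clin V" and E: "clin E" and S: "clin S"
    and ne: "(UNIV :: 'a set) \<noteq> {0}" "(UNIV :: 'b set) \<noteq> {0}"
    and VV: "dag V (V x) = x" and VE: "dag V (E y) = 0"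
    and SEE: "S (dag E (E y)) = dag E (E (S y))" for x y
    by (simp_all add: brownian_type_def bounded_opmats_def bounded_ops_UNIV Let_def)
  have norm_V: "norm (V x) = norm x" for x using isometry_iff_dag[OF V] VV by blast
  interpret minimal_extension S N J2
    using S assms(2) by unfold_locales
  obtain B where B: "pos_op B" "\<And>y. B (B y) = dag E (E y)"
    "\<And>T y. clin T \<Longrightarrow> (\<And>y. T (dag E (E y)) = dag E (E (T y))) \<Longrightarrow> T (B y) = B (T y)"
    using pos_sqrt[OF pos_op_dag_compose[OF E]] by blast
  have SB: "S (B y) = B (S y)" for y using S SEE by (rule B(3))
  obtain C where C: "pos_op C" "\<And>y. C (C y) = B y"
    "\<And>T y. clin T \<Longrightarrow> (\<And>y. T (B y) = B (T y)) \<Longrightarrow> T (C y) = C (T y)"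
    using pos_sqrt[OF B(1)] by blast
  have CS: "C (S y) = S (C y)" for y using C(3)[OF S SB] by simp
  obtain T where T: "selfadjoint T" "\<And>k y. T ((dag N ^^ k) (J2 y)) = (dag N ^^ k) (J2 (C y))"
    "\<And>x. T (N x) = N (T x)"
    using lift_commutant[OF pos_op_selfadjoint[OF C(1)] CS] by blast
  define Bt where "Bt x = T (T x)" for x
  have pos_Bt: "pos_op Bt" unfolding Bt_def by (rule selfadjoint_square_pos[OF T(1)])
  note sa_Bt = pos_op_selfadjoint[OF pos_Bt] and sa_B = pos_op_selfadjoint[OF B(1)]
  have Bt_J: "Bt (J2 y) = J2 (B y)" for y
    using T(2)[of 0] by (simp add: Bt_def C(2))
  have Bt_N: "Bt (N x) = N (Bt x)" for x by (simp add: Bt_def T(3))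
  have BE: "cinner (B y) (B y') = cinner (E y) (E y')" for y y'
    by (simp add: selfadjoint_cinner[OF sa_B] B(2) cinner_dag[OF E])
  have B_zero: "B y = 0 \<longleftrightarrow> E y = 0" for y
    using BE[of y y] cinner_eq_zero_iff by metis
  have dag_J_Bt: "dag J2 (Bt z) = B (dag J2 z)" for z
  proof (rule cinner_ext)
    show "cinner (dag J2 (Bt z)) y = cinner (B (dag J2 z)) y" for y
      by (simp add: cinner_dag'[OF clin_J] selfadjoint_cinner[OF sa_Bt] selfadjoint_cinner[OF sa_B] Bt_J)
  qed
  interpret brownian_data V E Bt N J2
  proof unfold_locales
    show "cinner (Bt (J2 y)) (Bt (J2 y')) = cinner (E y) (E y')" for y y'
      by (simp add: Bt_J cinner_J BE)
    show "E (dag J2 z) = 0" if "Bt z = 0" for z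
      using dag_J_Bt[of z] that clin_zero[OF clin_dag[OF clin_J]] B_zero by simp
    \<comment> \<open>Minimality enters here: \<open>Bt\<close> commutes with \<open>N\<close> and
      is intertwined with \<open>B\<close> by \<open>dag J2\<close>, so \<open>Bt z\<close> is
      orthogonal to all generators.\<close>
    show "Bt z = 0" if z: "\<And>k. E (dag J2 ((N ^^ k) z)) = 0" for z
    proof (rule gens_total, rule orthI)
      fix g assume "g \<in> gens"
      then obtain k y where g: "g = (dag N ^^ k) (J2 y)" by (auto simp: gens_def)
      have "dag J2 ((N ^^ k) (Bt z)) = B (dag J2 ((N ^^ k) z))"
        using funpow_commute[of Bt N, OF Bt_N] by (simp add: dag_J_Bt[symmetric])
      also have "\<dots> = 0" using z[of k] B_zero by blast
      finally show "cinner (Bt z) g = 0"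
        by (simp add: g cinner_funpow_dag[OF clin_N] cinner_dag'[OF clin_J, symmetric])
    qed
  qed (simp_all add: V E norm_V VE sa_Bt clin_N clin_J norm_J)
  obtain Vt Et J1 where "normal_model Vt Et J1" using normal_model_exists by blast
  then have Vt: "clin Vt" and Et: "clin Et" and J1: "clin J1"
    and norm_Vt: "norm (Vt x) = norm x" and norm_J1: "norm (J1 x) = norm x"
    and Et_Bt: "cinner (Et y) (Et z) = cinner (Bt y) (Bt z)" and Vt_Et: "dag Vt (Et z) = 0"
    and J1_V: "J1 (V x) = Vt (J1 x)" and J1_E: "J1 (E w) = Et (J2 w)"
    and total: "dag Vt x = 0 \<Longrightarrow> dag Et x = 0 \<Longrightarrow> x = 0" for x y z w
    unfolding normal_model_def by blast+
  have Et_Et: "dag Et (Et x) = Bt (Bt x)" for x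
  proof (rule cinner_ext)
    show "cinner (dag Et (Et x)) y = cinner (Bt (Bt x)) y" for y
      by (simp add: cinner_dag'[OF Et] Et_Bt selfadjoint_cinner[OF sa_Bt])
  qed
  have ne_c: "(UNIV :: 'c set) \<noteq> {0}"
  proof
    assume "(UNIV :: 'c set) = {0}"
    then have "J2 y = 0" for y by blast
    then have "y = 0" for y :: 'b using norm_J[of y] by simp
    then show False using ne(2) by blast
  qed
  have zero: "(\<lambda>_. 0) \<in> bounded_ops (UNIV :: 'a set) (UNIV :: 'c set)"
    by (simp add: bounded_ops_UNIV clin_zero_op)
  have "brownian_type UNIV UNIV (OpMat Vt Et (\<lambda>_. 0) N)"
    using isometry_iff_dag[OF Vt] norm_Vt ne(1) ne_c zero
    by (simp add: brownian_type_def bounded_opmats_def bounded_ops_UNIV Let_def hilbert_UNIV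
        Vt Et clin_N Vt_Et Et_Et Bt_N)
  moreover have "normal_op UNIV N"
    by (simp add: normal_op_def bounded_ops_UNIV clin_N normal)
  ultimately have normal: "OpMat Vt Et (\<lambda>_. 0) N \<in> brownian_normal UNIV UNIV"
    by (simp add: brownian_normal_def)
  have ext: "opmat_extension UNIV UNIV (OpMat V E (\<lambda>_. 0) S) UNIV UNIV (OpMat Vt Et (\<lambda>_. 0) N) J1 J2"
    by (simp add: opmat_extension_def isometric_embedding_def bounded_ops_UNIV J1 clin_J norm_J1 norm_J
        J1_V J1_E J_S clin_zero[OF clin_J])
  have "abs_op UNIV UNIV E = B" by (rule abs_op_eqI[OF B(1,2)])
  moreover have "abs_op UNIV UNIV Et = Bt" using pos_Bt Et_Et by (intro abs_op_eqI) simp_all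
  ultimately have abs: "op_extension UNIV (abs_op UNIV UNIV E) UNIV (abs_op UNIV UNIV Et) J2"
    by (simp add: op_extension_def isometric_embedding_def bounded_ops_UNIV clin_J norm_J Bt_J)
  let ?K = "closure (range Et)"
  have hil: "hilbert ?K"
  proof (rule hilbert_closure)
    show "0 \<in> range Et" using clin_zero[OF Et] by (metis rangeI)
  qed (auto simp: clin_add[OF Et, symmetric] clin_scaleC[OF Et, symmetric])
  have perp: "cinner (Vt x) y = 0" if "y \<in> ?K" for x y
  proof -
    have "?K \<subseteq> {y. cinner (Vt x) y = 0}"
    proof (rule closure_minimal)
      show "closed {y. cinner (Vt x) y = 0}" by (intro closed_Collect_eq continuous_intros)
    qed (auto simp: cinner_dag[OF Vt] Vt_Et)
    then show ?thesis using that by blast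
  qed
  have "\<exists>a p. x = Vt a + p \<and> p \<in> ?K" for x
  proof -
    \<comment> \<open>The component in \<open>ker Vt\<^sup>*\<close>. Its part \<open>q\<close> off
      the closure of \<open>ran Et\<close> is annihilated by both adjoints, hence zero.\<close>
    define w where "w = x - Vt (dag Vt x)"
    obtain p q where pq: "p \<in> ?K" "q \<in> orth ?K" "w = p + q" using orth_decompose[OF hil] by blast
    have "dag Vt w = 0"
      using isometry_iff_dag[OF Vt] norm_Vt by (simp add: w_def clin_diff[OF clin_dag[OF Vt]])
    moreover have "dag Vt p = 0"
      using perp[OF pq(1)] cinner_eq_zero_commute[of p] by (intro dag_zeroI Vt) blast
    ultimately have "dag Vt q = 0" by (simp add: pq(3) clin_add[OF clin_dag[OF Vt]])
    moreover have "dag Et q = 0"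
      using orthD[OF pq(2)] closure_subset by (intro dag_zeroI Et) blast
    ultimately have "q = 0" by (rule total)
    then have "x = Vt (dag Vt x) + p" using pq(3) by (simp add: w_def algebra_simps)
    then show ?thesis using pq(1) by blast
  qed
  then have sum: "orthogonal_sum UNIV (range Vt) ?K"
    using perp unfolding orthogonal_sum_def by blast
  \<comment> \<open>With the whole type as \<open>K1\<close> this is reflexivity; the actual
    comparison of cardinals was made in relabelling the basis.\<close>
  have "hdim (UNIV :: 'a set) =o hdim (UNIV :: 'a set)" by (simp add: hdim_def card_of_refl)
  then show ?thesis
    using hilbert_UNIV Vt Et normal ext abs hdim_eq sum
    by (intro exI[of _ UNIV] exI[of _ J1] exI[of _ Vt] exI[of _ Et]) (simp add: bounded_ops_UNIV)
qed

end
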